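(* Let $(\mathcal{X},d_{\mathcal{X}})$ be a finite metric space with $d_{\mathcal{X}}\le1$ and let $\mathcal{A}:\mathcal{X}\to\mathcal{Y}$ be a randomized algorithm satisfying $(\alpha_0,0)$-$d_{\mathcal{X}}$-DP. Let $\mathcal{M}$ be the mechanism which, on a dataset $K=\{x_1,\dots,x_N\}$, independently computes $\mathcal{A}(x_1),\dots,\mathcal{A}(x_N)$ and outputs these values in uniformly random order. For any $\delta\in(0,1)$, define $$h(M;x_0,x_1)=x_0\ln\!\left(1+\frac{\exp(\alpha_0x_1/x_0)-1}{\exp(\alpha_0x_1/x_0)+1}\left(\frac{8\sqrt{e^{\alpha_0}\ln(4x_0/\delta)}}{\sqrt M}+\frac{8e^{\alpha_0}}{M}\right)\right).$$ 1. (Local model.) $\mathcal{M}$, applied to datasets of size $m$, satisfies $(\alpha,\delta')$-bounded local $d_{\mathsf{EM}}$-DP with $$\alpha=\sup_{w\in(0,1]}\frac{h(m;m,mw)}{w},\qquad \delta'=\delta e^{h(m;m,m)}.$$ 2. (Central model.) $\mathcal{M}$, applied to the global dataset $K_G$ (of size $mn$) of $n$ users each holding $m$ items, satisfies $(\alpha,\delta')$-bounded central $d_{\mathsf{EM}}$-DP with $$\alpha=\sup_{w\in(0,1]}\frac{h(mn;m,mw)}{w},\qquad \delta'=\delta e^{h(mn;m,m)}.$$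
   Context: $\mathcal{A}$ satisfies $(\alpha_0,0)$-$d_{\mathcal{X}}$-DP if for all $x,x'\in\mathcal{X}$ and all sets of outputs $O$, $\Pr[\mathcal{A}(x)\in O]\le e^{\alpha_0d_{\mathcal{X}}(x,x')}\Pr[\mathcal{A}(x')\in O]$. A dataset is a nonempty finite multiset of elements of $\mathcal{X}$; $\tilde K$ is its empirical distribution, $\tilde K[x]=(\text{number of occurrences of }x\text{ in }K)/|K|$. The earth-mover's distance is $d_{\mathsf{EM}}(P,Q)=\inf_C\mathbb{E}_{(x,x')\sim C}[d_{\mathcal{X}}(x,x')]$ over couplings $C$ of $P,Q$. $(\alpha,\delta)$-bounded local $d_{\mathsf{EM}}$-DP (for datasets of size $m$): for all datasets $K,K'$ with $|K|=|K'|=m$ and all sets of outputs $O$, $\Pr[\mathcal{M}(K)\in O]\le e^{\alpha d_{\mathsf{EM}}(\tilde K,\tilde K')}\Pr[\mathcal{M}(K')\in O]+\delta$. $(\alpha,\delta)$-bounded central $d_{\mathsf{EM}}$-DP: user $i\in\{1,\dots,n\}$ holds $K_i\in\mathcal{X}^m$ (a multiset of size $m$), $K_G=K_1\cup\dots\cup K_n$ (multiset union); for all $K_G,K_G'$ where $K_G'$ is obtained from $K_G$ by replacing one user's dataset $K_i$ by $K_i'\in\mathcal{X}^m$, and all sets of outputs $O$, $\Pr[\mathcal{M}(K_G)\in O]\le e^{\alpha d_{\mathsf{EM}}(\tilde K_i,\tilde K_i')}\Pr[\mathcal{M}(K_G')\in O]+\delta$. *)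

theory Defs
  imports "HOL-Probability.Probability" "HOL-Combinatorics.Permutations"
begin

definition metric_DP :: "real \<Rightarrow> real \<Rightarrow> 'b measure \<Rightarrow> ('a::metric_space \<Rightarrow> 'b measure) \<Rightarrow> bool" where
  "metric_DP \<alpha> \<delta> Y A \<longleftrightarrow>
     (\<forall>x x'. \<forall>S\<in>sets Y. measure (A x) S \<le> exp (\<alpha> * dist x x') * measure (A x') S + \<delta>)"

definition couplings :: "'a pmf \<Rightarrow> 'a pmf \<Rightarrow> ('a \<times> 'a) pmf set" where
  "couplings P Q = {C. map_pmf fst C = P \<and> map_pmf snd C = Q}"

definition earth_mover_dist :: "'a::{finite,metric_space} pmf \<Rightarrow> 'a pmf \<Rightarrow> real" where
  "earth_mover_dist P Q =
     (INF C\<in>couplings P Q. measure_pmf.expectation C (\<lambda>(x, x'). dist x x'))"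

text \<open>
  Datasets are nonempty multisets, and \<open>pmf_of_multiset K\<close> is the empirical distribution of \<open>K\<close>.
  A mechanism maps a dataset to a measure; in the two definitions below, \<open>Z\<close> is the measurable
  space of its outputs.
\<close>

definition bounded_local_EM_DP ::
  "nat \<Rightarrow> real \<Rightarrow> real \<Rightarrow> 'c measure \<Rightarrow> ('a::{finite,metric_space} multiset \<Rightarrow> 'c measure) \<Rightarrow> bool"
where
  "bounded_local_EM_DP m \<alpha> \<delta> Z M \<longleftrightarrow>
     (\<forall>K K'. K \<noteq> {#} \<and> K' \<noteq> {#} \<and> size K = m \<and> size K' = m \<longrightarrow>
       (\<forall>S\<in>sets Z. measure (M K) S
          \<le> exp (\<alpha> * earth_mover_dist (pmf_of_multiset K) (pmf_of_multiset K')) * measure (M K') S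
            + \<delta>))"

definition bounded_central_EM_DP ::
  "nat \<Rightarrow> nat \<Rightarrow> real \<Rightarrow> real \<Rightarrow> 'c measure \<Rightarrow> ('a::{finite,metric_space} multiset \<Rightarrow> 'c measure) \<Rightarrow> bool"
where
  "bounded_central_EM_DP n m \<alpha> \<delta> Z M \<longleftrightarrow>
     (\<forall>K i K'. (\<forall>j\<in>{1..n}. K j \<noteq> {#} \<and> size (K j) = m) \<and> i \<in> {1..n} \<and> K' \<noteq> {#} \<and> size K' = m \<longrightarrow>
       (\<forall>S\<in>sets Z. measure (M (\<Sum>j=1..n. K j)) S
          \<le> exp (\<alpha> * earth_mover_dist (pmf_of_multiset (K i)) (pmf_of_multiset K'))
              * measure (M (\<Sum>j=1..n. (K(i := K')) j)) S
            + \<delta>))"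

text \<open>
  Output sequences of length \<open>N\<close> are elements of the product space over the index set
  \<open>{..<N}\<close>. The permutation and the outputs of \<open>A\<close> are drawn jointly independently.
\<close>

definition shuffle_list :: "'b measure \<Rightarrow> ('a \<Rightarrow> 'b measure) \<Rightarrow> 'a list \<Rightarrow> (nat \<Rightarrow> 'b) measure" where
  "shuffle_list Y A xs =
     (let N = length xs in
      distr (uniform_count_measure {\<sigma>. \<sigma> permutes {..<N}} \<Otimes>\<^sub>M (\<Pi>\<^sub>M i\<in>{..<N}. A (xs ! i)))
            (\<Pi>\<^sub>M i\<in>{..<N}. Y)
            (\<lambda>(\<sigma>, y). \<lambda>i\<in>{..<N}. y (\<sigma> i)))"

text \<open>
  The enumeration of the dataset is immaterial, see \<open>shuffle_mechanism_mset\<close> below.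
\<close>

definition shuffle_mechanism :: "'b measure \<Rightarrow> ('a \<Rightarrow> 'b measure) \<Rightarrow> 'a multiset \<Rightarrow> (nat \<Rightarrow> 'b) measure" where
  "shuffle_mechanism Y A K = shuffle_list Y A (SOME xs. mset xs = K)"

text \<open>
  For \<open>\<alpha>\<^sub>0 \<ge> 0\<close>, the quotients \<open>h_bound \<alpha>\<^sub>0 \<delta> M m (m * w) / w\<close> with \<open>w \<in> {0<..1}\<close> are bounded above
  (lemma \<open>bdd_above_h_bound\<close> below), so that their real-valued supremum is the actual one.
\<close>

definition h_bound :: "real \<Rightarrow> real \<Rightarrow> real \<Rightarrow> real \<Rightarrow> real \<Rightarrow> real" where
  "h_bound \<alpha>\<^sub>0 \<delta> M x\<^sub>0 x\<^sub>1 =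
     x\<^sub>0 * ln (1 + (exp (\<alpha>\<^sub>0 * x\<^sub>1 / x\<^sub>0) - 1) / (exp (\<alpha>\<^sub>0 * x\<^sub>1 / x\<^sub>0) + 1)
                * (8 * sqrt (exp \<alpha>\<^sub>0 * ln (4 * x\<^sub>0 / \<delta>)) / sqrt M + 8 * exp \<alpha>\<^sub>0 / M))"

lemma bdd_above_h_bound:
  fixes \<alpha>\<^sub>0 \<delta> M :: real and m :: nat
  assumes "\<alpha>\<^sub>0 \<ge> 0" "0 < \<delta>" "\<delta> < 1" "M > 0" "m \<ge> 1"
  shows "bdd_above ((\<lambda>w. h_bound \<alpha>\<^sub>0 \<delta> M (real m) (real m * w) / w) ` {0<..1})"
proof (rule bdd_aboveI2)
  define B where "B = 8 * sqrt (exp \<alpha>\<^sub>0 * ln (4 * real m / \<delta>)) / sqrt M + 8 * exp \<alpha>\<^sub>0 / M"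
  have "4 * real m / \<delta> \<ge> 1" using assms by (simp add: field_simps)
  then have B: "B \<ge> 0" unfolding B_def using assms by (intro add_nonneg_nonneg) auto
  fix w :: real assume w: "w \<in> {0<..1}"
  define z where "z = \<alpha>\<^sub>0 * w"
  have z: "z \<ge> 0" using w assms by (simp add: z_def)
  have "1 - z \<le> exp (- z)" using exp_ge_add_one_self[of "-z"] by simp
  then have "(1 - z) * exp z \<le> exp (-z) * exp z" by (intro mult_right_mono) auto
  then have "exp z - 1 \<le> z * (exp z + 1)" using z by (simp add: algebra_simps flip: exp_add)
  then have t: "(exp z - 1) / (exp z + 1) \<le> z" by (simp add: pos_divide_le_eq add_pos_pos)
  have t0: "0 \<le> (exp z - 1) / (exp z + 1)" using z by (intro divide_nonneg_nonneg) (auto intro: add_nonneg_nonneg)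
  have "ln (1 + (exp z - 1) / (exp z + 1) * B) \<le> (exp z - 1) / (exp z + 1) * B"
    by (rule ln_add_one_self_le_self) (rule mult_nonneg_nonneg[OF t0 B])
  also have "\<dots> \<le> z * B" using t B by (rule mult_right_mono)
  finally have l: "ln (1 + (exp z - 1) / (exp z + 1) * B) \<le> z * B" .
  have "h_bound \<alpha>\<^sub>0 \<delta> M (real m) (real m * w) = real m * ln (1 + (exp z - 1) / (exp z + 1) * B)"
    using assms by (simp add: h_bound_def B_def z_def)
  also have "\<dots> \<le> real m * (z * B)" using l by (intro mult_left_mono) auto
  finally show "h_bound \<alpha>\<^sub>0 \<delta> M (real m) (real m * w) / w \<le> real m * (\<alpha>\<^sub>0 * B)"
    using w by (simp add: z_def pos_divide_le_eq mult_ac)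
qed

lemma measurable_reorder:
  fixes N :: nat
  assumes "\<And>i. i < N \<Longrightarrow> sets (P i) = sets Y"
  shows "(\<lambda>(\<sigma>, y). \<lambda>i\<in>{..<N}. y (\<sigma> i))
    \<in> uniform_count_measure {\<sigma>. \<sigma> permutes {..<N}} \<Otimes>\<^sub>M (\<Pi>\<^sub>M i\<in>{..<N}. P i) \<rightarrow>\<^sub>M (\<Pi>\<^sub>M i\<in>{..<N}. Y)"
proof -
  have s: "sets (\<Pi>\<^sub>M i\<in>{..<N}. P i) = sets (\<Pi>\<^sub>M i\<in>{..<N}. Y)"
    using assms by (intro sets_PiM_cong) auto
  have "(\<lambda>(\<sigma>, y). \<lambda>i\<in>{..<N}. y (\<sigma> i)) \<in>
    count_space {\<sigma>. \<sigma> permutes {..<N}} \<Otimes>\<^sub>M (\<Pi>\<^sub>M i\<in>{..<N}. Y) \<rightarrow>\<^sub>M (\<Pi>\<^sub>M i\<in>{..<N}. Y)"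
  proof (rule measurable_pair_measure_countable1)
    show "countable {\<sigma>. \<sigma> permutes {..<N}}"
      by (intro countable_finite finite_permutations finite_lessThan)
    fix \<sigma> assume "\<sigma> \<in> {\<sigma>. \<sigma> permutes {..<N}}"
    then have "\<And>i. i < N \<Longrightarrow> \<sigma> i \<in> {..<N}" using permutes_in_image by fastforce
    then show "(\<lambda>y. case (\<sigma>, y) of (\<sigma>, y) \<Rightarrow> \<lambda>i\<in>{..<N}. y (\<sigma> i))
        \<in> (\<Pi>\<^sub>M i\<in>{..<N}. Y) \<rightarrow>\<^sub>M (\<Pi>\<^sub>M i\<in>{..<N}. Y)"
      by (auto intro!: measurable_restrict measurable_component_singleton)
  qed
  then show ?thesis
    by (subst measurable_cong_sets[OF sets_pair_measure_cong[OF _ s] refl])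
       (auto simp: sets_uniform_count_measure)
qed

lemma shuffle_list_prob_algebra:
  assumes A: "A \<in> count_space UNIV \<rightarrow>\<^sub>M prob_algebra Y"
  shows "shuffle_list Y A xs \<in> space (prob_algebra (\<Pi>\<^sub>M i\<in>{..<length xs}. Y))"
proof -
  have A': "prob_space (A x)" "sets (A x) = sets Y" for x
    using measurable_space[OF A, of x] by (auto simp: space_prob_algebra)
  interpret U: prob_space "uniform_count_measure {\<sigma>. \<sigma> permutes {..<length xs}}"
    by (rule prob_space_uniform_count_measure) (auto intro!: finite_permutations permutes_id)
  interpret P: prob_space "\<Pi>\<^sub>M i\<in>{..<length xs}. A (xs ! i)"
    by (intro prob_space_PiM A')
  interpret UP: pair_prob_space "uniform_count_measure {\<sigma>. \<sigma> permutes {..<length xs}}"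
    "\<Pi>\<^sub>M i\<in>{..<length xs}. A (xs ! i)" ..
  show ?thesis
    unfolding shuffle_list_def Let_def space_prob_algebra
    using UP.prob_space_distr[OF measurable_reorder[of "length xs" "\<lambda>i. A (xs ! i)" Y]] A'(2)
    by auto
qed

lemma distr_uniform_permutations:
  assumes p: "p permutes I" and I: "finite I"
  shows "distr (uniform_count_measure {\<sigma>. \<sigma> permutes I}) (uniform_count_measure {\<sigma>. \<sigma> permutes I})
           (\<lambda>\<sigma>. p \<circ> \<sigma>) = uniform_count_measure {\<sigma>. \<sigma> permutes I}"
    (is "distr ?U ?U ?f = ?U")
proof -
  let ?S = "{\<sigma>. \<sigma> permutes I}"
  have f: "?f \<in> ?U \<rightarrow>\<^sub>M ?U"
    by (auto simp: measurable_def space_uniform_count_measure sets_uniform_count_measure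
        intro: permutes_compose[OF _ p])
  have fin: "finite ?S" using I by (rule finite_permutations)
  show ?thesis
  proof (rule measure_eqI_finite[where A = ?S])
    show "sets (distr ?U ?U ?f) = Pow ?S" "sets ?U = Pow ?S"
      by (simp_all add: sets_uniform_count_measure)
    show "finite ?S" by (rule fin)
    fix \<tau> assume t: "\<tau> \<in> ?S"
    have "?f -` {\<tau>} \<inter> ?S = {inv p \<circ> \<tau>}"
    proof (intro equalityI subsetI)
      fix \<sigma> assume "\<sigma> \<in> ?f -` {\<tau>} \<inter> ?S"
      then have "p \<circ> \<sigma> = \<tau>" by auto
      then have "inv p \<circ> \<tau> = (inv p \<circ> p) \<circ> \<sigma>" by (auto simp: o_assoc)
      then show "\<sigma> \<in> {inv p \<circ> \<tau>}" using permutes_inv_o(2)[OF p] by simp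
    next
      fix \<sigma> assume "\<sigma> \<in> {inv p \<circ> \<tau>}"
      moreover have "p \<circ> (inv p \<circ> \<tau>) = \<tau>" using permutes_inv_o(1)[OF p] by (simp add: o_assoc)
      ultimately show "\<sigma> \<in> ?f -` {\<tau>} \<inter> ?S"
        using t permutes_compose[OF _ permutes_inv[OF p]] by auto
    qed
    moreover have "inv p \<circ> \<tau> \<in> ?S" using t permutes_compose[OF _ permutes_inv[OF p]] by auto
    ultimately show "emeasure (distr ?U ?U ?f) {\<tau>} = emeasure ?U {\<tau>}"
      using t fin f
      by (subst emeasure_distr)
         (auto simp: space_uniform_count_measure sets_uniform_count_measure emeasure_uniform_count_measure)
  qed
qed

lemma shuffle_list_cong_mset:
  assumes A: "A \<in> count_space UNIV \<rightarrow>\<^sub>M prob_algebra Y" and eq: "mset xs = mset ys"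
  shows "shuffle_list Y A xs = shuffle_list Y A ys"
proof -
  define N where "N = length ys"
  have len: "length xs = N" using mset_eq_length[OF eq] by (simp add: N_def)
  obtain p where p: "p permutes {..<N}" and xs: "permute_list p ys = xs"
    using mset_eq_permutation[OF eq] by (auto simp: N_def)
  have nth: "xs ! i = ys ! p i" if "i < N" for i
    using that xs permute_list_nth[of p ys i] p by (auto simp: N_def)
  have A': "prob_space (A x)" "sets (A x) = sets Y" for x
    using measurable_space[OF A, of x] by (auto simp: space_prob_algebra)
  let ?U = "uniform_count_measure {\<sigma>. \<sigma> permutes {..<N}}"
  let ?X = "\<Pi>\<^sub>M i\<in>{..<N}. A (xs ! i)" and ?Y = "\<Pi>\<^sub>M i\<in>{..<N}. A (ys ! i)"
  let ?F = "\<lambda>(\<sigma>, y). \<lambda>i\<in>{..<N}. y (\<sigma> i) :: 'b"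
  let ?f = "\<lambda>\<sigma>. inv p \<circ> \<sigma>" and ?g = "\<lambda>\<omega>. \<lambda>n\<in>{..<N}. \<omega> (p n) :: 'b"
  have pin: "i < N \<Longrightarrow> p i < N" for i using permutes_in_image[OF p, of i] by simp
  have X: "?X = (\<Pi>\<^sub>M i\<in>{..<N}. A (ys ! p i))"
    by (intro PiM_cong) (auto simp: nth)
  have dX: "distr ?Y ?X ?g = ?X"
    unfolding X using distr_PiM_reindex[of "{..<N}" "\<lambda>i. A (ys ! i)" p "{..<N}"] A' pin
    by (auto intro: inj_on_subset[OF permutes_inj[OF p]])
  have dU: "distr ?U ?U ?f = ?U"
    by (rule distr_uniform_permutations) (auto intro: permutes_inv p)
  have f: "?f \<in> ?U \<rightarrow>\<^sub>M ?U"
    by (auto simp: measurable_def space_uniform_count_measure sets_uniform_count_measure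
        intro: permutes_compose permutes_inv p)
  have g: "?g \<in> ?Y \<rightarrow>\<^sub>M ?X"
    unfolding X by (auto intro!: measurable_restrict measurable_component_singleton pin)
  interpret X: prob_space ?X by (intro prob_space_PiM A')
  have F: "?F \<in> ?U \<Otimes>\<^sub>M ?X \<rightarrow>\<^sub>M (\<Pi>\<^sub>M i\<in>{..<N}. Y)"
    by (rule measurable_reorder) (simp add: A')
  have fg: "(\<lambda>(x, y). (?f x, ?g y)) \<in> ?U \<Otimes>\<^sub>M ?Y \<rightarrow>\<^sub>M ?U \<Otimes>\<^sub>M ?X"
    using f g by measurable
  have "shuffle_list Y A xs = distr (?U \<Otimes>\<^sub>M ?X) (\<Pi>\<^sub>M i\<in>{..<N}. Y) ?F"
    by (simp add: shuffle_list_def Let_def len)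
  also have "?U \<Otimes>\<^sub>M ?X = distr ?U ?U ?f \<Otimes>\<^sub>M distr ?Y ?X ?g"
    by (simp only: dX dU)
  also have "\<dots> = distr (?U \<Otimes>\<^sub>M ?Y) (?U \<Otimes>\<^sub>M ?X) (\<lambda>(x, y). (?f x, ?g y))"
    by (rule pair_measure_distr[OF f g]) (simp only: dX, unfold_locales)
  also have "distr \<dots> (\<Pi>\<^sub>M i\<in>{..<N}. Y) ?F
      = distr (?U \<Otimes>\<^sub>M ?Y) (\<Pi>\<^sub>M i\<in>{..<N}. Y) (?F \<circ> (\<lambda>(x, y). (?f x, ?g y)))"
    by (rule distr_distr[OF F fg])
  also have "\<dots> = distr (?U \<Otimes>\<^sub>M ?Y) (\<Pi>\<^sub>M i\<in>{..<N}. Y) ?F"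
  proof (rule distr_cong[OF refl refl])
    fix z assume "z \<in> space (?U \<Otimes>\<^sub>M ?Y)"
    then obtain \<sigma> y where z: "z = (\<sigma>, y)" and s: "\<sigma> permutes {..<N}"
      by (auto simp: space_pair_measure space_uniform_count_measure)
    have "inv p (\<sigma> i) < N" if "i < N" for i
      using that permutes_in_image[OF s, of i] permutes_in_image[OF permutes_inv[OF p], of "\<sigma> i"] by simp
    then show "(?F \<circ> (\<lambda>(x, y). (?f x, ?g y))) z = ?F z"
      by (auto simp: z fun_eq_iff restrict_def permutes_inverses[OF p])
  qed
  also have "\<dots> = shuffle_list Y A ys" by (simp add: shuffle_list_def Let_def N_def)
  finally show ?thesis .
qed

lemma shuffle_mechanism_mset:
  assumes "A \<in> count_space UNIV \<rightarrow>\<^sub>M prob_algebra Y"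
  shows "shuffle_mechanism Y A (mset xs) = shuffle_list Y A xs"
  unfolding shuffle_mechanism_def
  by (rule shuffle_list_cong_mset[OF assms]) (rule someI[of _ xs], rule refl)

end

theory Submission
  imports Defs
begin

text \<open>
  Two datasets of size \<open>m\<close> are joined by an optimal matching of their elements, whose mean cost is at
  most the earth mover's distance \<open>w\<close> of the empirical distributions (Birkhoff and von Neumann).
  Replacing the matched elements one at a time, each replacement at distance \<open>d\<close> multiplies
  probabilities by at most \<open>1 + t B\<close> with \<open>t = tanh (\<alpha>\<^sub>0 d / 2)\<close>, up to an additive \<open>\<delta> / m\<close>: this is
  privacy amplification by shuffling, proved by the clone argument of Feldman, McMillan and Talwar.
  Concavity of \<open>ln (1 + B tanh (\<alpha>\<^sub>0 d / 2))\<close> in \<open>d\<close> bounds the product of the factors.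

  The clone argument needs \<open>B \<le> 2\<close>. For \<open>B > 2\<close> the claim is weaker than the privacy without
  shuffling, because the quotients \<open>h (m w) / w\<close> tend to \<open>m \<alpha>\<^sub>0 B / 2 \<ge> m \<alpha>\<^sub>0\<close> as \<open>w\<close> tends to 0.
\<close>

section \<open>Matchings and the earth mover's distance\<close>

text \<open>Averaging the indicator of an event over all permutations turns it into a symmetric test
  \<open>f\<close> on the unshuffled outputs, whose acceptance probability survives an exchange of
  two users.

  With \<open>B\<close> the bracket in \<open>h\<close> and
  \<open>L = ln (4 * m / \<delta>)\<close>, the first summand of the bracket gives
  \<open>64 * L \<le> exp (- \<alpha>\<^sub>0) * N * B\<^sup>2\<close>. This is what a Chernoff
  bound needs for the failure probability \<open>exp (- L) = \<delta> / (4 * m)\<close> when every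
  user is a clone with probability \<open>exp (- \<alpha>\<^sub>0)\<close>. The error of a
  replacement is multiplied by the factors of the earlier ones, together at most
  \<open>exp (h m)\<close>, whence the form of \<open>\<delta>'\<close>. The product of all factors
  is at most \<open>exp (h (m * w))\<close> for the mean cost \<open>w\<close> of the matching. The
  supremum bounds it by \<open>exp (\<alpha> * w)\<close>, where \<open>w\<close> may be replaced by
  the larger earth mover's distance.\<close>

text \<open>Induction by the argument of Halmos and Vaughan. If some proper nonempty
  \<open>J\<close> is tight, match it first and give the others only elements outside its
  neighbourhood; otherwise every proper nonempty subset has a spare neighbour, and one pair can be
  matched arbitrarily.\<close>

lemma hall_marriage:
  fixes N :: "'i \<Rightarrow> 'j set"
  assumes "finite I" "\<And>i. i \<in> I \<Longrightarrow> finite (N i)"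
    and "\<And>J. J \<subseteq> I \<Longrightarrow> card J \<le> card (\<Union>(N ` J))"
  shows "\<exists>f. inj_on f I \<and> (\<forall>i\<in>I. f i \<in> N i)"
  using assms
proof (induction I arbitrary: N rule: finite_psubset_induct)
  case (psubset I)
  note fin = psubset.prems(1) and hall = psubset.prems(2)
  have finU: "finite (\<Union>(N ` J))" if "J \<subseteq> I" for J
    using that fin finite_subset[OF that psubset.hyps] by auto
  show ?case
  proof (cases "I = {}")
    case False
    show ?thesis
    proof (cases "\<exists>J. J \<subset> I \<and> J \<noteq> {} \<and> card (\<Union>(N ` J)) = card J")
      case True
      then obtain J where J: "J \<subset> I" "J \<noteq> {}" and eq: "card (\<Union>(N ` J)) = card J" by blast
      have "\<exists>f. inj_on f J \<and> (\<forall>i\<in>J. f i \<in> N i)"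
        using J fin hall by (intro psubset.IH) auto
      then obtain f where f: "inj_on f J" "\<And>i. i \<in> J \<Longrightarrow> f i \<in> N i" by blast
      have "\<exists>g. inj_on g (I - J) \<and> (\<forall>i\<in>I - J. g i \<in> N i - \<Union>(N ` J))"
      proof (rule psubset.IH)
        fix K assume K: "K \<subseteq> I - J"
        have finJK: "finite J" "finite K" using J K psubset.hyps by (meson finite_subset psubset_imp_subset finite_Diff)+
        have "card J + card K = card (J \<union> K)"
          using finJK K by (subst card_Un_disjoint) auto
        also have "\<dots> \<le> card (\<Union>(N ` (J \<union> K)))" using J K by (intro hall) auto
        also have "\<Union>(N ` (J \<union> K)) = \<Union>(N ` J) \<union> (\<Union>i\<in>K. N i - \<Union>(N ` J))" by auto
        also have "card \<dots> = card (\<Union>(N ` J)) + card (\<Union>i\<in>K. N i - \<Union>(N ` J))"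
          using J K finJK finU[of J] finU[of K] by (intro card_Un_disjoint) (auto simp: subset_iff)
        finally show "card K \<le> card (\<Union>i\<in>K. N i - \<Union>(N ` J))" using eq by simp
      qed (use J fin in auto)
      then obtain g where g: "inj_on g (I - J)" "\<And>i. i \<in> I - J \<Longrightarrow> g i \<in> N i - \<Union>(N ` J)" by blast
      let ?h = "\<lambda>i. if i \<in> J then f i else g i"
      have "inj_on ?h I"
      proof (rule inj_onI)
        fix i j assume ij: "i \<in> I" "j \<in> I" "?h i = ?h j"
        show "i = j"
          using ij f(2)[of i] f(2)[of j] g(2)[of i] g(2)[of j] inj_onD[OF f(1), of i j] inj_onD[OF g(1), of i j]
          by (cases "i \<in> J"; cases "j \<in> J") auto
      qed
      moreover have "\<forall>i\<in>I. ?h i \<in> N i" using f g by auto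
      ultimately show ?thesis by blast
    next
      case strict: False
      obtain i where i: "i \<in> I" using False by blast
      have "card {i} \<le> card (\<Union>(N ` {i}))" using i by (intro hall) auto
      then obtain x where x: "x \<in> N i" by fastforce
      have "\<exists>g. inj_on g (I - {i}) \<and> (\<forall>j\<in>I - {i}. g j \<in> N j - {x})"
      proof (rule psubset.IH)
        fix K assume K: "K \<subseteq> I - {i}"
        show "card K \<le> card (\<Union>j\<in>K. N j - {x})"
        proof (cases "K = {}")
          case False
          then have "card (\<Union>(N ` K)) \<noteq> card K" using strict K i by blast
          moreover have "card K \<le> card (\<Union>(N ` K))" using K by (intro hall) auto
          moreover have "card (\<Union>(N ` K)) - card {x} \<le> card (\<Union>(N ` K) - {x})"
            by (intro diff_card_le_card_Diff) auto
          ultimately have "card K \<le> card (\<Union>(N ` K) - {x})"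
            unfolding is_singletonI[THEN is_singleton_altdef[THEN iffD1]] by linarith
          also have "\<Union>(N ` K) - {x} = (\<Union>j\<in>K. N j - {x})" by blast
          finally show ?thesis .
        qed auto
      qed (use i fin in auto)
      then obtain g where g: "inj_on g (I - {i})" "\<And>j. j \<in> I - {i} \<Longrightarrow> g j \<in> N j - {x}" by blast
      have "inj_on (g(i := x)) I"
      proof (rule inj_onI)
        fix j k assume jk: "j \<in> I" "k \<in> I" "(g(i := x)) j = (g(i := x)) k"
        show "j = k"
          using jk g(2)[of j] g(2)[of k] inj_onD[OF g(1), of j k] by (auto split: if_splits)
      qed
      moreover have "\<forall>j\<in>I. (g(i := x)) j \<in> N j" using g x by auto
      ultimately show ?thesis by blast
    qed
  qed auto
qed

text \<open>Subtracting a permutation matrix supported on the matrix keeps the line sums equal and shrinks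
  the support, as in the theorem of Birkhoff and von Neumann.\<close>

lemma constant_line_sums_cost_ge:
  fixes D c :: "'i \<Rightarrow> 'i \<Rightarrow> real"
  assumes fin: "finite I"
    and D: "\<And>i j. i \<in> I \<Longrightarrow> j \<in> I \<Longrightarrow> 0 \<le> D i j"
    and rows: "\<And>i. i \<in> I \<Longrightarrow> (\<Sum>j\<in>I. D i j) = s"
    and cols: "\<And>j. j \<in> I \<Longrightarrow> (\<Sum>i\<in>I. D i j) = s"
    and b: "\<And>\<sigma>. \<sigma> permutes I \<Longrightarrow> b \<le> (\<Sum>i\<in>I. c i (\<sigma> i))"
    and ne: "I \<noteq> {}"
  shows "s * b \<le> (\<Sum>i\<in>I. \<Sum>j\<in>I. D i j * c i j)"
  using D rows cols
proof (induction "card {(i, j) \<in> I \<times> I. 0 < D i j}" arbitrary: D s rule: less_induct)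
  case (less D s)
  note D = less.prems(1) and rows = less.prems(2) and cols = less.prems(3)
  have s: "0 \<le> s" using ne rows D by (metis ex_in_conv sum_nonneg)
  show ?case
  proof (cases "s = 0")
    case True
    then have "D i j = 0" if "i \<in> I" "j \<in> I" for i j
      using that rows[of i] D sum_nonneg_eq_0_iff[OF fin, of "D i"] by auto
    then show ?thesis using True by simp
  next
    case False
    then have s0: "s > 0" using s by simp
    let ?N = "\<lambda>i. {j \<in> I. 0 < D i j}"
    have "\<exists>f. inj_on f I \<and> (\<forall>i\<in>I. f i \<in> ?N i)"
    proof (rule hall_marriage)
      fix J assume J: "J \<subseteq> I"
      let ?U = "\<Union>(?N ` J)"
      have U: "?U \<subseteq> I" by auto
      \<comment> \<open>All mass of the rows in \<open>J\<close> lies in the columns of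
        \<open>?U\<close>, whose total mass is \<open>s * card ?U\<close>; dividing by
        \<open>s\<close> gives Hall's condition.\<close>
      have "s * card J = (\<Sum>i\<in>J. \<Sum>j\<in>I. D i j)" using rows J by (simp add: subset_iff)
      also have "\<dots> = (\<Sum>i\<in>J. \<Sum>j\<in>?U. D i j)"
      proof (rule sum.cong[OF refl])
        fix i assume i: "i \<in> J"
        have "D i j = 0" if "j \<in> I - ?U" for j
          using that i J D[of i j] by (force simp: not_less)
        then show "(\<Sum>j\<in>I. D i j) = (\<Sum>j\<in>?U. D i j)"
          using U fin by (intro sum.mono_neutral_right) auto
      qed
      also have "\<dots> \<le> (\<Sum>i\<in>I. \<Sum>j\<in>?U. D i j)"
        using J U fin D by (intro sum_mono2) (auto intro!: sum_nonneg)
      also have "\<dots> = (\<Sum>j\<in>?U. \<Sum>i\<in>I. D i j)" by (rule sum.swap)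
      also have "\<dots> = s * card ?U" using cols by simp
      finally show "card J \<le> card ?U" using s0 by simp
    qed (use fin in auto)
    then obtain f where f: "inj_on f I" "\<And>i. i \<in> I \<Longrightarrow> f i \<in> ?N i" by blast
    define \<sigma> where "\<sigma> i = (if i \<in> I then f i else i)" for i
    have "bij_betw f I I"
      using f fin by (intro bij_betw_imageI endo_inj_surj) auto
    then have bij: "bij_betw \<sigma> I I" by (subst bij_betw_cong[of I \<sigma> f]) (auto simp: \<sigma>_def)
    then have \<sigma>: "\<sigma> permutes I" by (rule bij_imp_permutes) (simp add: \<sigma>_def)
    have D\<sigma>: "i \<in> I \<Longrightarrow> \<sigma> i \<in> I \<and> 0 < D i (\<sigma> i)" for i using f(2)[of i] by (simp add: \<sigma>_def)
    \<comment> \<open>Subtracting the smallest entry on the permutation keeps the matrix nonnegative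
      and annihilates the entry at \<open>i\<^sub>0\<close>, so the support shrinks.\<close>
    define e where "e = Min ((\<lambda>i. D i (\<sigma> i)) ` I)"
    have e_le: "i \<in> I \<Longrightarrow> e \<le> D i (\<sigma> i)" for i using fin by (simp add: e_def)
    have "e \<in> (\<lambda>i. D i (\<sigma> i)) ` I" unfolding e_def using fin ne by (intro Min_in) auto
    then obtain i\<^sub>0 where i\<^sub>0: "i\<^sub>0 \<in> I" "e = D i\<^sub>0 (\<sigma> i\<^sub>0)" by blast
    define D' where "D' i j = D i j - (if j = \<sigma> i then e else 0)" for i j
    have e0: "e > 0" using i\<^sub>0 D\<sigma> by auto
    have "(s - e) * b \<le> (\<Sum>i\<in>I. \<Sum>j\<in>I. D' i j * c i j)"
    proof (rule less.hyps)
      have "{(i, j) \<in> I \<times> I. 0 < D' i j} \<subset> {(i, j) \<in> I \<times> I. 0 < D i j}"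
        using i\<^sub>0 D\<sigma>[of i\<^sub>0] e0 by (auto simp: D'_def split: if_splits)
      moreover have "finite {(i, j) \<in> I \<times> I. 0 < D i j}"
        using fin by (auto intro: finite_subset[of _ "I \<times> I"])
      ultimately show "card {(i, j) \<in> I \<times> I. 0 < D' i j} < card {(i, j) \<in> I \<times> I. 0 < D i j}"
        by (rule psubset_card_mono[rotated])
      show "0 \<le> D' i j" if "i \<in> I" "j \<in> I" for i j
        using that D[of i j] e_le[of i] by (simp add: D'_def)
      show "(\<Sum>j\<in>I. D' i j) = s - e" if "i \<in> I" for i
        using that rows[of i] D\<sigma>[of i] fin by (simp add: D'_def sum_subtractf)
      show "(\<Sum>i\<in>I. D' i j) = s - e" if "j \<in> I" for j
      proof -
        have "(\<Sum>i\<in>I. if j = \<sigma> i then e else 0) = (\<Sum>i\<in>I. if j = i then e else 0)"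
          by (rule sum.reindex_bij_betw[OF bij])
        then show ?thesis using that cols[of j] fin by (simp add: D'_def sum_subtractf)
      qed
    qed
    also have "\<dots> = (\<Sum>i\<in>I. \<Sum>j\<in>I. D i j * c i j) - e * (\<Sum>i\<in>I. c i (\<sigma> i))"
    proof -
      have "(\<Sum>j\<in>I. D' i j * c i j) = (\<Sum>j\<in>I. D i j * c i j) - e * c i (\<sigma> i)" if "i \<in> I" for i
        using that D\<sigma>[of i] fin
        by (simp add: D'_def sum_subtractf left_diff_distrib if_distrib[of "\<lambda>x. x * _"] cong: if_cong)
      then show ?thesis by (simp add: sum_subtractf sum_distrib_left)
    qed
    also have "\<dots> \<le> (\<Sum>i\<in>I. \<Sum>j\<in>I. D i j * c i j) - e * b"
      using b[OF \<sigma>] e0 by simp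
    finally show ?thesis by (simp add: algebra_simps)
  qed
qed

lemma sum_nth_eq_sum_count:
  fixes g :: "'a::finite \<Rightarrow> real"
  shows "(\<Sum>i<length xs. g (xs ! i)) = (\<Sum>x\<in>UNIV. of_nat (count (mset xs) x) * g x)"
proof -
  have "(\<Sum>i<length xs. g (xs ! i)) = sum_list (map g xs)"
    by (simp add: sum_list_sum_nth atLeast0LessThan)
  also have "\<dots> = (\<Sum>x\<in>UNIV. of_nat (count (mset xs) x) * g x)"
  proof (induction xs)
    case (Cons a xs)
    have "(\<Sum>x\<in>UNIV. of_nat (count (mset (a # xs)) x) * g x)
        = (\<Sum>x\<in>UNIV. (if a = x then g x else 0) + of_nat (count (mset xs) x) * g x)"
      by (intro sum.cong) (auto simp: algebra_simps)
    then show ?case using Cons by (simp add: sum.distrib)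
  qed simp
  finally show ?thesis .
qed

text \<open>A coupling is a matrix indexed by values, a matching is indexed by positions. Spreading
  the mass of each pair of values evenly over the pairs of positions that carry it gives a matrix on
  positions with all line sums \<open>1 / m\<close> and the same cost, to which the bound by
  permutations applies.\<close>

lemma earth_mover_dist_ge:
  fixes xs ys :: "'a::{finite,metric_space} list"
  assumes len: "length xs = m" "length ys = m" and m: "m \<ge> 1"
    and b: "\<And>\<sigma>. \<sigma> permutes {..<m} \<Longrightarrow> b \<le> (\<Sum>i<m. dist (xs ! i) (ys ! \<sigma> i))"
  shows "b / real m \<le> earth_mover_dist (pmf_of_multiset (mset xs)) (pmf_of_multiset (mset ys))"
    (is "_ \<le> earth_mover_dist ?P ?Q")
  unfolding earth_mover_dist_def
proof (rule cINF_greatest)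
  have "pair_pmf ?P ?Q \<in> couplings ?P ?Q"
    by (simp add: couplings_def map_fst_pair_pmf map_snd_pair_pmf)
  then show "couplings ?P ?Q \<noteq> {}" by blast
  fix C assume "C \<in> couplings ?P ?Q"
  then have C: "map_pmf fst C = ?P" "map_pmf snd C = ?Q" by (auto simp: couplings_def)
  have ne: "mset xs \<noteq> {#}" "mset ys \<noteq> {#}" using len m by auto
  have rowC: "(\<Sum>y\<in>UNIV. pmf C (x, y)) = count (mset xs) x / m" for x
  proof -
    have "count (mset xs) x / m = pmf (map_pmf fst C) x" using C ne len by simp
    also have "\<dots> = measure C (fst -` {x})" by (simp add: pmf_map)
    also have "\<dots> = (\<Sum>z\<in>Pair x ` UNIV. pmf C z)"
      by (subst measure_measure_pmf_finite) (auto intro!: sum.cong)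
    finally show ?thesis by (simp add: sum.reindex inj_on_def)
  qed
  have colC: "(\<Sum>x\<in>UNIV. pmf C (x, y)) = count (mset ys) y / m" for y
  proof -
    have "count (mset ys) y / m = pmf (map_pmf snd C) y" using C ne len by simp
    also have "\<dots> = measure C (snd -` {y})" by (simp add: pmf_map)
    also have "\<dots> = (\<Sum>z\<in>(\<lambda>x. (x, y)) ` UNIV. pmf C z)"
      by (subst measure_measure_pmf_finite) (auto intro!: sum.cong)
    finally show ?thesis by (simp add: sum.reindex inj_on_def)
  qed
  \<comment> \<open>\<open>D\<close> below divides by counts that may be 0. The coupling has no mass
    there, so the default value 0 of the quotient is the right one.\<close>
  have C0: "pmf C (x, y) = 0" if "count (mset xs) x = 0 \<or> count (mset ys) y = 0" for x y
  proof -
    have "pmf C (x, y) \<le> (\<Sum>y\<in>UNIV. pmf C (x, y))" "pmf C (x, y) \<le> (\<Sum>x\<in>UNIV. pmf C (x, y))"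
      by (auto intro!: member_le_sum)
    then have "pmf C (x, y) \<le> 0"
      unfolding rowC colC using that by (elim disjE) (simp_all only: of_nat_0 div_0)
    then show ?thesis using pmf_nonneg[of C "(x, y)"] by linarith
  qed
  define D where "D x y = pmf C (x, y) / (count (mset xs) x * count (mset ys) y)" for x y
  have Dy: "(\<Sum>y\<in>UNIV. count (mset ys) y * (D x y * g y)) = (\<Sum>y\<in>UNIV. pmf C (x, y) * g y) / count (mset xs) x"
    for x and g :: "'a \<Rightarrow> real"
    unfolding sum_divide_distrib by (intro sum.cong refl) (use C0 in \<open>auto simp: D_def\<close>)
  have Dx: "(\<Sum>x\<in>UNIV. count (mset xs) x * D x y) = (\<Sum>x\<in>UNIV. pmf C (x, y)) / count (mset ys) y" for y
    unfolding sum_divide_distrib by (intro sum.cong refl) (use C0 in \<open>auto simp: D_def\<close>)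
  have "b / real m = 1 / real m * b" by simp
  also have "\<dots> \<le> (\<Sum>i<m. \<Sum>j<m. D (xs ! i) (ys ! j) * dist (xs ! i) (ys ! j))"
  proof (rule constant_line_sums_cost_ge)
    show "0 \<le> D (xs ! i) (ys ! j)" for i j by (simp add: D_def)
    show "(\<Sum>j<m. D (xs ! i) (ys ! j)) = 1 / real m" if "i \<in> {..<m}" for i
    proof -
      have "xs ! i \<in> set xs" using that len by auto
      then have "count (mset xs) (xs ! i) > 0" by simp
      then show ?thesis
        using sum_nth_eq_sum_count[of "D (xs ! i)" ys] Dy[of "xs ! i" "\<lambda>_. 1"] rowC[of "xs ! i"] len
        by simp
    qed
    show "(\<Sum>i<m. D (xs ! i) (ys ! j)) = 1 / real m" if "j \<in> {..<m}" for j
    proof -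
      have "ys ! j \<in> set ys" using that len by auto
      then have "count (mset ys) (ys ! j) > 0" by simp
      then show ?thesis
        using sum_nth_eq_sum_count[of "\<lambda>x. D x (ys ! j)" xs] Dx[of "ys ! j"] colC[of "ys ! j"] len
        by simp
    qed
  qed (use b m in \<open>auto simp: lessThan_empty_iff\<close>)
  also have "\<dots> = (\<Sum>x\<in>UNIV. \<Sum>y\<in>UNIV. pmf C (x, y) * dist x y)"
  proof -
    have "(\<Sum>i<m. \<Sum>j<m. D (xs ! i) (ys ! j) * dist (xs ! i) (ys ! j))
        = (\<Sum>i<m. (\<Sum>y\<in>UNIV. pmf C (xs ! i, y) * dist (xs ! i) y) / count (mset xs) (xs ! i))"
      using sum_nth_eq_sum_count[of "\<lambda>y. D _ y * dist _ y" ys] len by (simp add: Dy)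
    also have "\<dots> = (\<Sum>x\<in>UNIV. \<Sum>y\<in>UNIV. pmf C (x, y) * dist x y)"
      using sum_nth_eq_sum_count[of "\<lambda>x. (\<Sum>y\<in>UNIV. pmf C (x, y) * dist x y) / count (mset xs) x" xs] len
      by (simp, intro sum.cong refl) (use C0 in auto)
    finally show ?thesis .
  qed
  also have "\<dots> = measure_pmf.expectation C (\<lambda>(x, x'). dist x x')"
    by (subst integral_measure_pmf_real[of UNIV])
       (auto simp: sum.cartesian_product UNIV_Times_UNIV mult.commute intro!: sum.cong)
  finally show "b / real m \<le> \<dots>" .
qed

section \<open>Amplification by clones\<close>

text \<open>\<open>f\<close> stands for the probability, over the random order, that the shuffled
  outputs fall into a fixed event.\<close>

locale symmetric_test = prob_space \<mu> for \<mu> :: "'b measure" +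
  fixes N :: nat and f :: "(nat \<Rightarrow> 'b) \<Rightarrow> real"
  assumes f_meas: "f \<in> borel_measurable (\<Pi>\<^sub>M i\<in>{..<N}. \<mu>)"
    and f_bounds: "\<And>y. 0 \<le> f y" "\<And>y. f y \<le> 1"
    and f_sym: "\<And>\<tau> y. \<tau> permutes {..<N} \<Longrightarrow> f (\<lambda>i\<in>{..<N}. y (\<tau> i)) = f y"
begin

sublocale P: product_prob_space "\<lambda>_::nat. \<mu>" "{..<N}"
  by unfold_locales

definition \<Phi> :: "(nat \<Rightarrow> 'b \<Rightarrow> real) \<Rightarrow> real" where
  "\<Phi> g = (\<integral>y. f y * (\<Prod>i<N. g i (y i)) \<partial>(\<Pi>\<^sub>M i\<in>{..<N}. \<mu>))"

lemma integrable_test: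
  assumes "\<And>i. i < N \<Longrightarrow> integrable \<mu> (g i)"
  shows "integrable (\<Pi>\<^sub>M i\<in>{..<N}. \<mu>) (\<lambda>y. f y * (\<Prod>i<N. g i (y i)))"
proof -
  have *: "integrable (\<Pi>\<^sub>M i\<in>{..<N}. \<mu>) (\<lambda>y. \<Prod>i<N. g i (y i))"
    using assms by (intro P.product_integrable_prod) auto
  show ?thesis
  proof (rule Bochner_Integration.integrable_bound[OF *])
    show "(\<lambda>y. f y * (\<Prod>i<N. g i (y i))) \<in> borel_measurable (\<Pi>\<^sub>M i\<in>{..<N}. \<mu>)"
      using f_meas * by (intro borel_measurable_times) auto
    show "AE y in \<Pi>\<^sub>M i\<in>{..<N}. \<mu>. norm (f y * (\<Prod>i<N. g i (y i))) \<le> norm (\<Prod>i<N. g i (y i))"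
      using f_bounds by (intro AE_I2) (simp add: abs_mult mult_left_le_one_le)
  qed
qed

lemma \<Phi>_mono:
  assumes "\<And>i. i < N \<Longrightarrow> integrable \<mu> (g i)" "\<And>i. i < N \<Longrightarrow> integrable \<mu> (h i)"
    and "\<And>y. (\<Prod>i<N. g i (y i)) \<le> c * (\<Prod>i<N. h i (y i))"
  shows "\<Phi> g \<le> c * \<Phi> h"
  unfolding \<Phi>_def integral_mult_right_zero[symmetric]
proof (rule integral_mono)
  show "integrable (\<Pi>\<^sub>M i\<in>{..<N}. \<mu>) (\<lambda>y. c * (f y * (\<Prod>i<N. h i (y i))))"
    using assms by (intro integrable_mult_right integrable_test)
  fix y :: "nat \<Rightarrow> 'b"
  show "f y * (\<Prod>i<N. g i (y i)) \<le> c * (f y * (\<Prod>i<N. h i (y i)))"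
    using mult_left_mono[OF assms(3)[of y] f_bounds(1)[of y]] by (simp add: mult_ac)
qed (use assms integrable_test in auto)

lemma \<Phi>_nonneg:
  assumes "\<And>i y. i < N \<Longrightarrow> 0 \<le> g i y"
  shows "0 \<le> \<Phi> g"
  unfolding \<Phi>_def using assms f_bounds
  by (intro Bochner_Integration.integral_nonneg mult_nonneg_nonneg prod_nonneg) auto

lemma \<Phi>_le_prod:
  assumes "\<And>i. i < N \<Longrightarrow> integrable \<mu> (g i)" "\<And>i y. i < N \<Longrightarrow> 0 \<le> g i y"
  shows "\<Phi> g \<le> (\<Prod>i<N. \<integral>y. g i y \<partial>\<mu>)"
proof -
  have "\<Phi> g \<le> (\<integral>y. (\<Prod>i<N. g i (y i)) \<partial>(\<Pi>\<^sub>M i\<in>{..<N}. \<mu>))"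
    unfolding \<Phi>_def
  proof (rule integral_mono)
    show "integrable (\<Pi>\<^sub>M i\<in>{..<N}. \<mu>) (\<lambda>y. \<Prod>i<N. g i (y i))"
      using assms by (intro P.product_integrable_prod) auto
    show "f y * (\<Prod>i<N. g i (y i)) \<le> (\<Prod>i<N. g i (y i))" for y
      using assms f_bounds by (intro mult_left_le_one_le prod_nonneg) auto
  qed (use assms integrable_test in auto)
  also have "\<dots> = (\<Prod>i<N. \<integral>y. g i y \<partial>\<mu>)"
    using assms by (intro P.product_integral_prod) auto
  finally show ?thesis .
qed

text \<open>This is where shuffling enters: reordering the coordinates preserves both the product
  measure and \<open>f\<close>, so the test cannot tell which user has which density.\<close>

lemma \<Phi>_permute:
  assumes \<tau>: "\<tau> permutes {..<N}" and g: "\<And>i. i < N \<Longrightarrow> g i \<in> borel_measurable \<mu>"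
  shows "\<Phi> (g \<circ> \<tau>) = \<Phi> g"
proof -
  let ?P = "\<Pi>\<^sub>M i\<in>{..<N}. \<mu>" and ?r = "\<lambda>y. \<lambda>i\<in>{..<N}. y (\<tau> i)"
  have d: "distr ?P ?P ?r = ?P"
    using distr_PiM_reindex[of "{..<N}" "\<lambda>_. \<mu>" \<tau> "{..<N}"] prob_space_axioms
      permutes_in_image[OF \<tau>] inj_on_subset[OF permutes_inj[OF \<tau>]] by auto
  have r: "?r \<in> ?P \<rightarrow>\<^sub>M ?P"
    using permutes_in_image[OF \<tau>] by (auto intro!: measurable_restrict measurable_component_singleton)
  have g': "(\<lambda>y. \<Prod>i<N. (g \<circ> \<tau>) i (y i)) \<in> borel_measurable ?P"
  proof (intro borel_measurable_prod)
    fix i assume i: "i \<in> {..<N}"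
    then have "g (\<tau> i) \<in> borel_measurable \<mu>" using g permutes_in_image[OF \<tau>, of i] by auto
    from measurable_compose[OF measurable_component_singleton[OF i] this]
    show "(\<lambda>y. (g \<circ> \<tau>) i (y i)) \<in> borel_measurable ?P" by simp
  qed
  have "\<Phi> (g \<circ> \<tau>) = (\<integral>y. f y * (\<Prod>i<N. (g \<circ> \<tau>) i (y i)) \<partial>distr ?P ?P ?r)"
    by (simp only: d \<Phi>_def)
  also have "\<dots> = (\<integral>y. f (?r y) * (\<Prod>i<N. (g \<circ> \<tau>) i (?r y i)) \<partial>?P)"
    using r g' f_meas by (intro integral_distr borel_measurable_times)
  also have "\<dots> = \<Phi> g"
    unfolding \<Phi>_def
  proof (rule Bochner_Integration.integral_cong[OF refl])
    fix y :: "nat \<Rightarrow> 'b"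
    have "(\<Prod>i<N. (g \<circ> \<tau>) i (?r y i)) = (\<Prod>i<N. g (\<tau> i) (y (\<tau> i)))"
      by (intro prod.cong) auto
    also have "\<dots> = (\<Prod>i<N. g i (y i))"
      using prod.permute[OF \<tau>, of "\<lambda>i. g i (y i)"] by (simp add: o_def)
    finally show "f (?r y) * (\<Prod>i<N. (g \<circ> \<tau>) i (?r y i)) = f y * (\<Prod>i<N. g i (y i))"
      using f_sym[OF \<tau>, of y] by simp
  qed
  finally show ?thesis .
qed

lemma prod_fun_upd_remove:
  fixes g :: "nat \<Rightarrow> 'b \<Rightarrow> real"
  assumes "k < N"
  shows "(\<Prod>i<N. (g(k := q)) i (y i)) = q (y k) * (\<Prod>i\<in>{..<N} - {k}. g i (y i))"
proof -
  have "(\<Prod>i\<in>{..<N} - {k}. (g(k := q)) i (y i)) = (\<Prod>i\<in>{..<N} - {k}. g i (y i))"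
    by (intro prod.cong) auto
  then show ?thesis using assms by (subst prod.remove[of _ k]) auto
qed

lemma \<Phi>_linear:
  assumes k: "k < N" and "integrable \<mu> q" "integrable \<mu> q'"
    and "\<And>i. i < N \<Longrightarrow> i \<noteq> k \<Longrightarrow> integrable \<mu> (g i)"
  shows "\<Phi> (g(k := \<lambda>y. a * q y + b * q' y)) = a * \<Phi> (g(k := q)) + b * \<Phi> (g(k := q'))"
proof -
  have "integrable (\<Pi>\<^sub>M i\<in>{..<N}. \<mu>) (\<lambda>y. f y * (\<Prod>i<N. (g(k := q)) i (y i)))"
    "integrable (\<Pi>\<^sub>M i\<in>{..<N}. \<mu>) (\<lambda>y. f y * (\<Prod>i<N. (g(k := q')) i (y i)))"
    using assms by (intro integrable_test; auto)+
  then show ?thesis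
    unfolding \<Phi>_def integral_mult_right_zero[symmetric]
    by (subst Bochner_Integration.integral_add[symmetric])
       (auto simp: prod_fun_upd_remove[OF k] algebra_simps intro!: integrable_mult_right
        simp del: fun_upd_apply)
qed

text \<open>The sum runs over the assignments of a mixture component to every user except
  \<open>k\<close>, which amounts to conditioning on these choices.\<close>

lemma \<Phi>_expand:
  assumes k: "k < N" and T: "finite T" and q: "integrable \<mu> q"
    and h: "\<And>i s. i < N \<Longrightarrow> s \<in> T \<Longrightarrow> integrable \<mu> (h i s)"
  shows "\<Phi> ((\<lambda>i y. \<Sum>s\<in>T. w s * h i s y)(k := q))
    = (\<Sum>s\<in>({..<N} - {k}) \<rightarrow>\<^sub>E T. (\<Prod>i\<in>{..<N} - {k}. w (s i)) * \<Phi> ((\<lambda>i. h i (s i))(k := q)))"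
proof -
  let ?J = "{..<N} - {k}"
  have "\<Phi> ((\<lambda>i y. \<Sum>s\<in>T. w s * h i s y)(k := q))
      = (\<integral>y. (\<Sum>s\<in>?J \<rightarrow>\<^sub>E T. (\<Prod>i\<in>?J. w (s i))
          * (f y * (\<Prod>i<N. ((\<lambda>i. h i (s i))(k := q)) i (y i)))) \<partial>(\<Pi>\<^sub>M i\<in>{..<N}. \<mu>))"
    unfolding \<Phi>_def prod_fun_upd_remove[OF k]
    by (subst prod_sum_PiE) (auto simp: T prod.distrib sum_distrib_left mult_ac)
  also have "\<dots> = (\<Sum>s\<in>?J \<rightarrow>\<^sub>E T. (\<Prod>i\<in>?J. w (s i)) * \<Phi> ((\<lambda>i. h i (s i))(k := q)))"
    unfolding \<Phi>_def integral_mult_right_zero[symmetric]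
  proof (rule Bochner_Integration.integral_sum, rule integrable_mult_right, rule integrable_test)
    fix s i assume "s \<in> ?J \<rightarrow>\<^sub>E T" "i < N"
    then show "integrable \<mu> (((\<lambda>i. h i (s i))(k := q)) i)"
      using h q by (auto simp: PiE_iff)
  qed
  finally show ?thesis .
qed

text \<open>Each of the other users is a clone of the distinguished one with probability \<open>p\<close>: its output is
  then \<open>q0\<close> or \<open>q1\<close> distributed with equal probability (labels 0 and 1). Exchanging the distinguished
  user with one of the \<open>v\<close> clones of label 1 turns \<open>q0\<close> into \<open>q1\<close>, so that double counting compares
  the two outcomes up to the factor \<open>(u + 1) / v\<close>. This factor exceeds \<open>1 + B\<close> with small probability
  only, by a Chernoff bound with parameter \<open>\<theta>\<close>.\<close>

lemma clone_bound:
  fixes p B \<theta> :: real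
  assumes k: "k < N"
    and q: "integrable \<mu> q0" "integrable \<mu> q1" "\<And>y. 0 \<le> q0 y" "\<And>y. 0 \<le> q1 y"
      "(\<integral>y. q0 y \<partial>\<mu>) = 1" "(\<integral>y. q1 y \<partial>\<mu>) = 1"
    and l: "\<And>i. i < N \<Longrightarrow> integrable \<mu> (l i)" "\<And>i y. i < N \<Longrightarrow> 0 \<le> l i y"
      "\<And>i. i < N \<Longrightarrow> (\<integral>y. l i y \<partial>\<mu>) = 1 - p"
    and r: "\<And>i y. i < N \<Longrightarrow> r i y = p / 2 * q0 y + p / 2 * q1 y + l i y"
    and p: "0 \<le> p" "p \<le> 1" and B: "0 \<le> B" and \<theta>: "0 \<le> \<theta>"
    and chernoff: "exp \<theta> * (p / 2 * exp \<theta> + p / 2 * exp (- \<theta> * (1 + B)) + (1 - p)) ^ (N - 1) \<le> \<eta>"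
  shows "\<Phi> (r(k := q0)) \<le> (1 + B) * \<Phi> (r(k := q1)) + \<eta>"
proof -
  define J where "J = {..<N} - {k}"
  define T where "T = {0, 1, 2 :: nat}"
  define S where "S = J \<rightarrow>\<^sub>E T"
  \<comment> \<open>Label 2 is a user that is no clone. Its weight is 1 since \<open>l i\<close>
    itself carries the mass \<open>1 - p\<close>.\<close>
  define w where "w s = (if s = 2 then 1 else p / 2)" for s :: nat
  define h where "h i s = (if s = 0 then q0 else if s = 1 then q1 else l i)" for i and s :: nat
  define W where "W s = (\<Prod>i\<in>J. w (s i))" for s :: "nat \<Rightarrow> nat"
  define F where "F q s = W s * \<Phi> ((\<lambda>i. h i (s i))(k := q))" for q s
  define u where "u s = card {i\<in>J. s i = 0}" for s :: "nat \<Rightarrow> nat"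
  define v where "v s = card {i\<in>J. s i = 1}" for s :: "nat \<Rightarrow> nat"
  \<comment> \<open>A good labelling has \<open>v s > 0\<close>, as the left-hand side is positive,
    and hence a partner for the exchange.\<close>
  define good where "good s \<longleftrightarrow> real (u s) + 1 \<le> (1 + B) * real (v s)" for s
  have J: "finite J" "k \<notin> J" "card J = N - 1" using k by (auto simp: J_def)
  have T: "finite T" by (simp add: T_def)
  have S: "finite S" using J T by (auto simp: S_def intro: finite_PiE)
  have sT: "s i \<in> T" if "s \<in> S" "i \<in> J" for s i using that by (auto simp: S_def)
  have h_int: "integrable \<mu> (h i s)" if "i < N" for i s using that q l by (auto simp: h_def)
  have h_nonneg: "0 \<le> h i s y" if "i < N" for i s y using that q l by (auto simp: h_def)
  have h_meas: "h i s \<in> borel_measurable \<mu>" if "i < N" for i s using h_int[OF that, of s] by auto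
  have r_eq: "r i = (\<lambda>y. \<Sum>s\<in>T. w s * h i s y)" if "i < N" for i
    using r[OF that] by (auto simp: T_def w_def h_def)
  have expand: "\<Phi> (r(k := q)) = (\<Sum>s\<in>S. F q s)" if "integrable \<mu> q" for q
  proof -
    have "\<Phi> (r(k := q)) = \<Phi> ((\<lambda>i y. \<Sum>s\<in>T. w s * h i s y)(k := q))"
      unfolding \<Phi>_def by (intro Bochner_Integration.integral_cong refl arg_cong2[where f = "(*)"] prod.cong)
        (auto simp: r_eq)
    then show ?thesis
      using \<Phi>_expand[OF k T that, of h w] h_int by (simp add: F_def W_def S_def J_def)
  qed
  have W0: "0 \<le> W s" for s using p by (auto simp: W_def w_def intro!: prod_nonneg)
  have F0: "0 \<le> F q s" if "\<And>y. 0 \<le> q y" for q s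
    unfolding F_def by (intro mult_nonneg_nonneg W0 \<Phi>_nonneg) (use that h_nonneg in auto)
  \<comment> \<open>The exchange hands \<open>q1\<close> from the clone \<open>i\<close> to
    \<open>k\<close> and leaves \<open>q0\<close> with \<open>i\<close>, which thereby gets label 0.
    The weight is unchanged since labels 0 and 1 both weigh \<open>p / 2\<close>.\<close>
  have swap: "F q0 s = F q1 (s(i := 0))" if i: "i \<in> J" "s i = 1" for s i
  proof -
    have iN: "i < N" "i \<noteq> k" using i by (auto simp: J_def)
    have "((\<lambda>i. h i (s i))(k := q0)) \<circ> Transposition.transpose k i = (\<lambda>j. h j ((s(i := 0)) j))(k := q1)"
      using i iN by (auto simp: fun_eq_iff Transposition.transpose_def h_def)
    moreover have "\<Phi> (((\<lambda>i. h i (s i))(k := q0)) \<circ> Transposition.transpose k i) = \<Phi> ((\<lambda>i. h i (s i))(k := q0))"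
      using k iN q h_meas by (intro \<Phi>_permute permutes_swap_id) auto
    moreover have "W s = W (s(i := 0))"
      unfolding W_def using i by (intro prod.cong) (auto simp: w_def)
    ultimately show ?thesis by (simp add: F_def)
  qed
  have uv_upd: "u (s(i := 1)) + 1 = u s \<and> v (s(i := 1)) = v s + 1" if i: "i \<in> J" "s i = 0" for s i
  proof -
    have "{j\<in>J. s j = 0} = insert i {j\<in>J. (s(i := 1)) j = 0}"
      "{j\<in>J. (s(i := 1)) j = 1} = insert i {j\<in>J. s j = 1}" using i by auto
    then show ?thesis using i J by (simp add: u_def v_def)
  qed
  \<comment> \<open>Each labelling is shared equally among its possible partners, and the shares are
    regrouped by the labelling \<open>s\<close> after the exchange. This \<open>s\<close> receives
    at most \<open>u s\<close> shares, each a fraction \<open>1 / (v s + 1)\<close>, because the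
    exchange has used up one clone of label 1.\<close>
  have "(\<Sum>s\<in>{s\<in>S. good s}. F q0 s) = (\<Sum>s\<in>{s\<in>S. good s}. \<Sum>i\<in>{i\<in>J. s i = 1}. F q0 s / v s)"
  proof (rule sum.cong[OF refl])
    fix s assume "s \<in> {s\<in>S. good s}"
    then have "v s \<noteq> 0" unfolding good_def by (auto intro: ccontr)
    then show "F q0 s = (\<Sum>i\<in>{i\<in>J. s i = 1}. F q0 s / v s)" by (simp add: v_def)
  qed
  also have "\<dots> = (\<Sum>(s, i)\<in>(SIGMA s:{s\<in>S. good s}. {i\<in>J. s i = 1}). F q0 s / v s)"
    using S J by (intro sum.Sigma) auto
  also have "\<dots> = (\<Sum>(s, i)\<in>(SIGMA s:S. {i\<in>J. s i = 0 \<and> good (s(i := 1))}). F q1 s / (v s + 1))"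
  proof (rule sum.reindex_bij_witness[where i = "\<lambda>(s, i). (s(i := 1), i)" and j = "\<lambda>(s, i). (s(i := 0), i)"],
      goal_cases)
    case (1 a)
    then show ?case by auto
  next
    case (2 a)
    then obtain s i where a: "a = (s, i)" "s \<in> S" "good s" "i \<in> J" "s i = 1" by auto
    then have "s(i := 1) = s" by auto
    then show ?case using a by (auto simp: S_def PiE_iff extensional_def T_def)
  next
    case (3 b)
    then show ?case by auto
  next
    case (4 b)
    then obtain s i where b: "b = (s, i)" "s \<in> S" "i \<in> J" "s i = 0" "good (s(i := 1))" by auto
    then have "s(i := 1) \<in> S" unfolding S_def T_def by (intro PiE_fun_upd[of 1 _ i s J, unfolded insert_absorb[OF b(3)]]) auto
    then show ?case using b by auto
  next
    case (5 a)
    then obtain s i where a: "a = (s, i)" "s \<in> S" "good s" "i \<in> J" "s i = 1" by auto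
    then have "s(i := 1) = s" by auto
    then show ?case using a swap[of i s] uv_upd[of i "s(i := 0)"] by simp
  qed
  also have "\<dots> = (\<Sum>s\<in>S. \<Sum>i\<in>{i\<in>J. s i = 0 \<and> good (s(i := 1))}. F q1 s / (v s + 1))"
    using S J by (intro sum.Sigma[symmetric]) auto
  also have "\<dots> \<le> (\<Sum>s\<in>S. (1 + B) * F q1 s)"
  proof (rule sum_mono)
    fix s assume s: "s \<in> S"
    have F1: "0 \<le> F q1 s" using q by (intro F0)
    have gd: "good (s(i := 1)) \<longleftrightarrow> u s \<le> (1 + B) * (v s + 1)" if "i \<in> J" "s i = 0" for i
    proof -
      have "real (u s) = real (u (s(i := 1))) + 1" "real (v (s(i := 1))) = real (v s + 1)"
        using uv_upd[of i s] that by (metis of_nat_1 of_nat_add)+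
      then show ?thesis unfolding good_def by simp
    qed
    show "(\<Sum>i\<in>{i\<in>J. s i = 0 \<and> good (s(i := 1))}. F q1 s / (v s + 1)) \<le> (1 + B) * F q1 s"
    proof (cases "u s \<le> (1 + B) * (v s + 1)")
      case True
      then have "{i\<in>J. s i = 0 \<and> good (s(i := 1))} = {i\<in>J. s i = 0}" using gd by auto
      then have "(\<Sum>i\<in>{i\<in>J. s i = 0 \<and> good (s(i := 1))}. F q1 s / (v s + 1)) = u s / (v s + 1) * F q1 s"
        by (simp add: u_def)
      also have "\<dots> \<le> (1 + B) * F q1 s"
        using True F1 by (intro mult_right_mono) (auto simp: divide_simps)
      finally show ?thesis .
    next
      case False
      then have empty: "{i\<in>J. s i = 0 \<and> good (s(i := 1))} = {}" using gd by auto
      show ?thesis unfolding empty using B F1 by simp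
    qed
  qed
  also have "\<dots> = (1 + B) * \<Phi> (r(k := q1))" using q expand by (simp add: sum_distrib_left)
  finally have G: "(\<Sum>s\<in>{s\<in>S. good s}. F q0 s) \<le> (1 + B) * \<Phi> (r(k := q1))" .
  \<comment> \<open>Integrating the components turns the weights into the label probabilities
    \<open>w'\<close>; \<open>c\<close> is the exponential tilt of the Chernoff bound, summing to
    \<open>\<theta> * (u s - (1 + B) * v s)\<close>.\<close>
  define w' where "w' s = (if s = 2 then 1 - p else p / 2)" for s :: nat
  define c where "c s = (if s = 0 then \<theta> else if s = 1 then - \<theta> * (1 + B) else 0)" for s :: nat
  have F_le: "F q0 s \<le> (\<Prod>i\<in>J. w' (s i))" if s: "s \<in> S" for s
  proof -
    have "\<Phi> ((\<lambda>i. h i (s i))(k := q0)) \<le> (\<Prod>i<N. \<integral>y. ((\<lambda>i. h i (s i))(k := q0)) i y \<partial>\<mu>)"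
      using q h_int h_nonneg by (intro \<Phi>_le_prod) auto
    also have "\<dots> = (\<Prod>i\<in>J. \<integral>y. h i (s i) y \<partial>\<mu>)"
      using k q unfolding J_def by (subst prod.remove[of _ k]) (auto intro!: prod.cong)
    finally have "F q0 s \<le> (\<Prod>i\<in>J. w (s i)) * (\<Prod>i\<in>J. \<integral>y. h i (s i) y \<partial>\<mu>)"
      unfolding F_def W_def[symmetric] by (intro mult_left_mono W0)
    also have "\<dots> = (\<Prod>i\<in>J. w' (s i))"
      unfolding prod.distrib[symmetric]
    proof (intro prod.cong refl)
      fix i assume "i \<in> J"
      then have "i < N" "s i \<in> T" using sT[OF s] by (auto simp: J_def)
      then show "w (s i) * (\<integral>y. h i (s i) y \<partial>\<mu>) = w' (s i)"
        using q l by (auto simp: w_def w'_def h_def T_def)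
    qed
    finally show ?thesis .
  qed
  have c_sum: "(\<Sum>i\<in>J. c (s i)) = \<theta> * (u s - (1 + B) * v s)" for s
  proof -
    have "(\<Sum>i\<in>J. c (s i)) = (\<Sum>i\<in>J. (if s i = 0 then \<theta> else 0) - (if s i = 1 then \<theta> * (1 + B) else 0))"
      by (intro sum.cong) (auto simp: c_def)
    also have "\<dots> = \<theta> * (u s - (1 + B) * v s)"
      using J by (simp add: sum_subtractf u_def v_def right_diff_distrib flip: sum.inter_filter)
    finally show ?thesis .
  qed
  have w'0: "0 \<le> (\<Prod>i\<in>J. w' (s i))" for s using p by (intro prod_nonneg) (auto simp: w'_def)
  \<comment> \<open>On a bad labelling the tilt times \<open>exp \<theta>\<close> is at least 1.
    Once extended to all labellings, the sum factorises over the users.\<close>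
  have "(\<Sum>s\<in>{s\<in>S. \<not> good s}. F q0 s) \<le> (\<Sum>s\<in>{s\<in>S. \<not> good s}. exp \<theta> * (\<Prod>i\<in>J. exp (c (s i)) * w' (s i)))"
  proof (rule sum_mono)
    fix s assume s: "s \<in> {s\<in>S. \<not> good s}"
    then have "F q0 s \<le> 1 * (\<Prod>i\<in>J. w' (s i))" using F_le by simp
    also have "\<dots> \<le> exp (\<theta> + (\<Sum>i\<in>J. c (s i))) * (\<Prod>i\<in>J. w' (s i))"
    proof (intro mult_right_mono w'0)
      have "\<theta> + (\<Sum>i\<in>J. c (s i)) = \<theta> * (u s + 1 - (1 + B) * v s)"
        unfolding c_sum by (simp add: algebra_simps)
      also have "\<dots> \<ge> 0" using s \<theta> by (simp add: good_def)
      finally show "1 \<le> exp (\<theta> + (\<Sum>i\<in>J. c (s i)))" by simp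
    qed
    also have "\<dots> = exp \<theta> * (\<Prod>i\<in>J. exp (c (s i)) * w' (s i))"
      using J by (simp add: exp_add exp_sum prod.distrib)
    finally show "F q0 s \<le> exp \<theta> * (\<Prod>i\<in>J. exp (c (s i)) * w' (s i))" .
  qed
  also have "\<dots> \<le> (\<Sum>s\<in>S. exp \<theta> * (\<Prod>i\<in>J. exp (c (s i)) * w' (s i)))"
    using S p by (intro sum_mono2) (auto intro!: mult_nonneg_nonneg prod_nonneg simp: w'_def)
  also have "\<dots> = exp \<theta> * (\<Prod>i\<in>J. \<Sum>s\<in>T. exp (c s) * w' s)"
    using J T unfolding S_def sum_distrib_left[symmetric] by (subst prod_sum_PiE) auto
  also have "\<dots> = exp \<theta> * (p / 2 * exp \<theta> + p / 2 * exp (- \<theta> * (1 + B)) + (1 - p)) ^ (N - 1)"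
    using J by (simp add: T_def c_def w'_def algebra_simps)
  also have "\<dots> \<le> \<eta>" by (rule chernoff)
  finally have "(\<Sum>s\<in>{s\<in>S. \<not> good s}. F q0 s) \<le> \<eta>" .
  moreover have "\<Phi> (r(k := q0)) = (\<Sum>s\<in>{s\<in>S. good s}. F q0 s) + (\<Sum>s\<in>{s\<in>S. \<not> good s}. F q0 s)"
  proof -
    have "S = {s\<in>S. good s} \<union> {s\<in>S. \<not> good s}" by blast
    moreover have "(\<Sum>s\<in>{s\<in>S. good s} \<union> {s\<in>S. \<not> good s}. F q0 s)
        = (\<Sum>s\<in>{s\<in>S. good s}. F q0 s) + (\<Sum>s\<in>{s\<in>S. \<not> good s}. F q0 s)"
      using S by (intro sum.union_disjoint) auto
    ultimately show ?thesis using q expand by metis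
  qed
  ultimately show ?thesis using G by simp
qed

end

text \<open>As \<open>1 + B \<le> 3\<close>, quadratic bounds on the exponentials give \<open>exp
  \<theta> + exp (- \<theta> * (1 + B)) \<le> 2 - \<theta> * B + 11 / 2 * \<theta>\<^sup>2\<close>,
  where the last coefficient is 1 from the first exponential plus 9 / 2 from the second. The
  right-hand side is least at \<open>\<theta> = B / 11\<close>, with value
  \<open>2 - B\<^sup>2 / 22\<close>. The exponent \<open>64 / 44 * L\<close> then leaves room for
  the remaining constants.\<close>

lemma clone_chernoff_bound:
  fixes p B L :: real
  assumes p: "0 < p" "p \<le> 1" and L: "1 \<le> L" and B: "0 \<le> B" "B \<le> 2" "64 * L \<le> p * N * B\<^sup>2"
  shows "exp (B / 11) * (p / 2 * exp (B / 11) + p / 2 * exp (- (B / 11) * (1 + B)) + (1 - p)) ^ (N - 1)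
    \<le> exp (- L)"
proof -
  have N: "N \<noteq> 0" using B L by (auto intro: ccontr)
  define x where "x = B / 11 * (1 + B)"
  have x: "0 \<le> x" using B by (simp add: x_def)
  have "1 + x + x\<^sup>2 / 2 \<le> exp x" using exp_lower_Taylor_quadratic[OF x] by simp
  \<comment> \<open>The product is \<open>1 + x ^ 4 / 4\<close>, so the lower Taylor bound of
    \<open>exp x\<close> yields an upper bound of \<open>exp (- x)\<close>.\<close>
  moreover have "1 \<le> (1 - x + x\<^sup>2 / 2) * (1 + x + x\<^sup>2 / 2)"
    using zero_le_power_eq[of x 4] by (simp add: power2_eq_square algebra_simps power4_eq_xxxx)
  moreover have "0 < 1 - x + x\<^sup>2 / 2"
  proof -
    have "1 - x + x\<^sup>2 / 2 = ((x - 1)\<^sup>2 + 1) / 2" by (simp add: power2_eq_square algebra_simps)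
    moreover have "0 < ((x - 1)\<^sup>2 + 1) / 2" by (intro divide_pos_pos add_nonneg_pos) auto
    ultimately show ?thesis by simp
  qed
  ultimately have "1 \<le> (1 - x + x\<^sup>2 / 2) * exp x"
    by (meson mult_left_mono less_imp_le order_trans)
  then have e2: "exp (- x) \<le> 1 - x + x\<^sup>2 / 2" by (simp add: exp_minus divide_simps)
  have e1: "exp (B / 11) \<le> 1 + B / 11 + (B / 11)\<^sup>2" using B by (intro exp_bound) auto
  have x2: "x\<^sup>2 \<le> (B / 11)\<^sup>2 * 9"
  proof -
    have "(1 + B)\<^sup>2 \<le> 3\<^sup>2" using B by (intro power_mono) auto
    then show ?thesis unfolding x_def power_mult_distrib by (intro mult_left_mono) auto
  qed
  have "exp (B / 11) + exp (- x) \<le> 2 + (B / 11 - x) + (B / 11)\<^sup>2 * (11 / 2)"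
    using e1 e2 x2 by simp
  also have "\<dots> = 2 - B\<^sup>2 / 22"
    by (simp add: x_def power2_eq_square field_simps)
  finally have "p / 2 * (exp (B / 11) + exp (- x)) \<le> p / 2 * (2 - B\<^sup>2 / 22)"
    using p by (intro mult_left_mono) auto
  then have "p / 2 * exp (B / 11) + p / 2 * exp (- x) + (1 - p) \<le> 1 + (- p * B\<^sup>2 / 44)"
    by (simp add: algebra_simps)
  also have "\<dots> \<le> exp (- p * B\<^sup>2 / 44)" by (rule exp_ge_add_one_self)
  finally have "(p / 2 * exp (B / 11) + p / 2 * exp (- x) + (1 - p)) ^ (N - 1)
      \<le> exp (- p * B\<^sup>2 / 44) ^ (N - 1)"
    using p by (intro power_mono) auto
  also have "\<dots> = exp ((N - 1) * (- p * B\<^sup>2 / 44))" by (rule exp_of_nat_mult[symmetric])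
  finally have "exp (B / 11) * (p / 2 * exp (B / 11) + p / 2 * exp (- x) + (1 - p)) ^ (N - 1)
      \<le> exp (B / 11) * exp ((N - 1) * (- p * B\<^sup>2 / 44))" by (intro mult_left_mono) auto
  also have "\<dots> = exp (B / 11 - (N - 1) * (p * B\<^sup>2 / 44))" by (simp add: exp_add[symmetric])
  also have "\<dots> \<le> exp (- L)"
  proof -
    have "p * B\<^sup>2 \<le> 1 * 2\<^sup>2" using p B by (intro mult_mono power_mono) auto
    \<comment> \<open>There are only \<open>N - 1\<close> other users; the missing one costs
      \<open>p * B\<^sup>2 \<le> 4\<close>, which is absorbed together with the factor
      \<open>exp (B / 11)\<close> because \<open>L \<ge> 1\<close>.\<close>
    then have "64 * L - 4 \<le> p * N * B\<^sup>2 - p * B\<^sup>2" using B by simp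
    also have "p * N * B\<^sup>2 - p * B\<^sup>2 = (N - 1) * (p * B\<^sup>2)"
      using N by (simp add: of_nat_diff algebra_simps)
    finally have "B / 11 - (N - 1) * (p * B\<^sup>2) / 44 \<le> - L" using L B(1,2) by linarith
    then show ?thesis by (simp only: exp_le_cancel_iff times_divide_eq_right)
  qed
  finally show ?thesis by (simp add: x_def)
qed

section \<open>The amplification factor as a function of the distance\<close>

text \<open>The fraction is \<open>tanh (z / 2)\<close>. With \<open>B\<close> the bracket in
  \<open>h_bound\<close> and \<open>z = \<alpha>\<^sub>0 * x\<^sub>1 / x\<^sub>0\<close>, the value
  of \<open>h_bound\<close> is \<open>x\<^sub>0 * ln (amp B z)\<close>.\<close>

definition amp :: "real \<Rightarrow> real \<Rightarrow> real" where
  "amp B z = 1 + (exp z - 1) / (exp z + 1) * B"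

lemma amp_mono: "0 \<le> B \<Longrightarrow> y \<le> z \<Longrightarrow> amp B y \<le> amp B z"
proof -
  assume B: "0 \<le> B" and yz: "y \<le> z"
  have eq: "(exp z - 1) / (exp z + 1) = 1 - 2 / (exp z + 1)" for z :: real
    using exp_gt_zero[of z] by (simp add: divide_simps del: exp_gt_zero)
  show "amp B y \<le> amp B z"
    unfolding amp_def eq using yz B
    by (intro add_left_mono mult_right_mono diff_left_mono divide_left_mono) (auto intro!: add_pos_pos mult_pos_pos)
qed

lemma amp_0 [simp]: "amp B 0 = 1"
  by (simp add: amp_def)

lemma amp_ge_1: "0 \<le> B \<Longrightarrow> 0 \<le> z \<Longrightarrow> 1 \<le> amp B z"
  using amp_mono[of B 0 z] by simp

lemma amp_has_derivative:
  "(amp B has_real_derivative 2 * exp z / (exp z + 1)\<^sup>2 * B) (at z)"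
proof -
  have "exp z + 1 \<noteq> 0" using exp_gt_zero[of z] by linarith
  then have "((\<lambda>z. 1 + (exp z - 1) / (exp z + 1) * B) has_real_derivative
      (exp z * (exp z + 1) - (exp z - 1) * exp z) / ((exp z + 1) * (exp z + 1)) * B) (at z)"
    by (auto intro!: derivative_eq_intros simp: algebra_simps)
  also have "(exp z * (exp z + 1) - (exp z - 1) * exp z) / ((exp z + 1) * (exp z + 1))
      = 2 * exp z / (exp z + 1)\<^sup>2"
    by (simp add: power2_eq_square algebra_simps)
  finally show ?thesis unfolding amp_def .
qed

text \<open>The derivative of \<open>ln (amp B z)\<close> is a quotient whose numerator decreases
  for \<open>z \<ge> 0\<close> and whose denominator increases.\<close>

lemma convex_neg_ln_amp:
  assumes B: "0 \<le> B"
  shows "convex_on {0..} (\<lambda>z. - ln (amp B z))"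
proof (rule convex_on_realI)
  fix z :: real assume "z \<in> {0..}"
  then have "0 < amp B z" using amp_ge_1[OF B, of z] by simp
  then show "((\<lambda>z. - ln (amp B z)) has_real_derivative
      - (2 * exp z / (exp z + 1)\<^sup>2 * B / amp B z)) (at z)"
    by (auto intro!: derivative_eq_intros amp_has_derivative)
next
  fix y z :: real assume y: "y \<in> {0..}" and z: "z \<in> {0..}" and yz: "y \<le> z"
  \<comment> \<open>This is \<open>1 / (1 + cosh z)\<close>, so its monotonicity comes from that of
    \<open>cosh\<close>.\<close>
  have eq: "2 * exp z / (exp z + 1)\<^sup>2 = 2 / (exp z + 2 + exp (- z))" for z :: real
  proof -
    have "(exp z + 1)\<^sup>2 = exp z * (exp z + 2 + exp (- z))"
      by (simp add: power2_eq_square algebra_simps exp_minus)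
    then show ?thesis by simp
  qed
  have "exp y + exp (- y) \<le> exp z + exp (- z)"
    using cosh_real_nonneg_le_iff[of y z] y z yz by (simp add: cosh_def)
  then have "2 * exp z / (exp z + 1)\<^sup>2 \<le> 2 * exp y / (exp y + 1)\<^sup>2"
    unfolding eq by (intro divide_left_mono) (auto intro!: mult_pos_pos add_pos_pos)
  moreover have "amp B y \<le> amp B z" "0 < amp B y"
    using amp_mono[OF B yz] amp_ge_1[OF B, of y] y by auto
  ultimately have "2 * exp z / (exp z + 1)\<^sup>2 * B / amp B z \<le> 2 * exp y / (exp y + 1)\<^sup>2 * B / amp B y"
    using B by (intro frac_le[OF _ mult_right_mono]) simp_all
  then show "- (2 * exp y / (exp y + 1)\<^sup>2 * B / amp B y) \<le> - (2 * exp z / (exp z + 1)\<^sup>2 * B / amp B z)"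
    by simp
qed auto

text \<open>Jensen's inequality for the concave \<open>ln (amp B z)\<close>: individual distances
  give way to their mean, the quantity that the matching controls.\<close>

lemma prod_amp_le:
  fixes d :: "nat \<Rightarrow> real"
  assumes m: "m \<ge> 1" and B: "0 \<le> B" and d: "\<And>i. i < m \<Longrightarrow> 0 \<le> d i"
  shows "(\<Prod>i<m. amp B (d i)) \<le> exp (m * ln (amp B ((\<Sum>i<m. d i) / m)))"
proof -
  have "- ln (amp B (\<Sum>i<m. (1 / m) *\<^sub>R d i)) \<le> (\<Sum>i<m. 1 / m * - ln (amp B (d i)))"
    using convex_neg_ln_amp[OF B] m d by (intro convex_on_sum) (auto simp: lessThan_empty_iff)
  then have *: "(\<Sum>i<m. ln (amp B (d i))) \<le> m * ln (amp B ((\<Sum>i<m. d i) / m))"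
    using m by (simp add: sum_negf sum_divide_distrib[symmetric] pos_divide_le_eq mult.commute)
  have "amp B (d i) > 0" if "i < m" for i using amp_ge_1[OF B d[OF that]] by simp
  then have "(\<Prod>i<m. amp B (d i)) = exp (\<Sum>i<m. ln (amp B (d i)))"
    by (simp add: exp_sum)
  then show ?thesis using * by simp
qed

lemma sup_amp_ge_linear:
  assumes B: "2 \<le> B" and a: "0 \<le> a"
    and \<alpha>: "\<And>w. 0 < w \<Longrightarrow> w \<le> 1 \<Longrightarrow> real m * ln (amp B (a * w)) / w \<le> \<alpha>"
  shows "m * a \<le> \<alpha>"
proof -
  \<comment> \<open>As \<open>ln (amp B 0) = 0\<close>, the quotient is a difference quotient at 0;
    the slope of \<open>amp B\<close> there is \<open>B / 2\<close>.\<close>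
  have "((\<lambda>w. real m * ln (amp B (a * w))) has_real_derivative m * (B / 2 * a)) (at 0)"
  proof -
    have "((\<lambda>w. amp B (a * w)) has_real_derivative B / 2 * a) (at 0)"
      using amp_has_derivative[of B "a * 0"] 
      by (intro DERIV_chain2[where f = "amp B" and g = "\<lambda>w. a * w"])
         (auto intro!: derivative_eq_intros simp: power2_eq_square)
    then show ?thesis by (auto intro!: derivative_eq_intros)
  qed
  then have "((\<lambda>w. real m * ln (amp B (a * w)) / w) \<longlongrightarrow> m * (B / 2 * a)) (at 0)"
    by (simp add: has_field_derivative_iff)
  then have "((\<lambda>w. real m * ln (amp B (a * w)) / w) \<longlongrightarrow> m * (B / 2 * a)) (at_right 0)"
    by (rule filterlim_mono) (auto intro: at_le)
  moreover have "\<forall>\<^sub>F w in at_right 0. real m * ln (amp B (a * w)) / w \<le> \<alpha>"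
    using \<alpha> by (auto simp: eventually_at_right_field intro!: exI[of _ 1])
  ultimately have "m * (B / 2 * a) \<le> \<alpha>"
    by (intro tendsto_upperbound) auto
  moreover have "m * (1 * a) \<le> m * (B / 2 * a)"
    using B a by (intro mult_left_mono mult_right_mono) auto
  ultimately show ?thesis by simp
qed

section \<open>Densities and the shuffled mechanism\<close>

text \<open>The hypothesis is tested on the set \<open>Z\<close> where the conclusion fails: the
  excess integrates to 0 there, hence vanishes. Finiteness of the second measure permits the
  subtraction.\<close>

lemma density_le_imp_AE_le:
  fixes f g :: "'b \<Rightarrow> ennreal"
  assumes [measurable]: "f \<in> borel_measurable M" "g \<in> borel_measurable M"
    and fin: "finite_measure (density M g)"
    and le: "\<And>S. S \<in> sets M \<Longrightarrow> emeasure (density M f) S \<le> emeasure (density M g) S"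
  shows "AE y in M. f y \<le> g y"
proof -
  define Z where "Z = {y\<in>space M. g y < f y}"
  have Z[measurable]: "Z \<in> sets M" unfolding Z_def by measurable
  have "(\<integral>\<^sup>+y. g y * indicator Z y \<partial>M) \<noteq> \<infinity>"
    using finite_measure.emeasure_finite[OF fin, of Z] by (simp add: emeasure_density)
  moreover have "AE y in M. g y * indicator Z y \<le> f y * indicator Z y"
    by (auto simp: Z_def indicator_def)
  ultimately have "(\<integral>\<^sup>+y. f y * indicator Z y - g y * indicator Z y \<partial>M)
      = (\<integral>\<^sup>+y. f y * indicator Z y \<partial>M) - (\<integral>\<^sup>+y. g y * indicator Z y \<partial>M)"
    by (intro nn_integral_diff) auto
  also have "\<dots> = 0"
    using le[OF Z] finite_measure.emeasure_finite[OF fin, of Z]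
    by (intro diff_eq_0_ennreal) (auto simp: emeasure_density less_top[symmetric] top_unique)
  finally have "AE y in M. f y * indicator Z y - g y * indicator Z y = 0"
    by (subst (asm) nn_integral_0_iff_AE) auto
  then show ?thesis
  proof (rule AE_mp, intro AE_I2 impI)
    fix y assume y: "y \<in> space M" and 0: "f y * indicator Z y - g y * indicator Z y = 0"
    show "f y \<le> g y"
    proof (rule ccontr)
      assume "\<not> f y \<le> g y"
      then have "y \<in> Z" "g y < f y" using y by (auto simp: Z_def)
      then show False using 0 diff_gr0_ennreal[of "g y" "f y"] by simp
    qed
  qed
qed

text \<open>Pure privacy makes all \<open>A a\<close> mutually absolutely continuous, so any one
  serves as reference. As there are finitely many inputs, the exceptional null sets combine into
  one; redefining all densities as 0 there makes the ratio bounds hold everywhere.\<close>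

lemma metric_DP_densities:
  fixes A :: "'a::{finite,metric_space} \<Rightarrow> 'b measure"
  assumes A: "A \<in> count_space UNIV \<rightarrow>\<^sub>M prob_algebra Y" and DP: "metric_DP \<alpha>\<^sub>0 0 Y A"
  obtains \<mu> :: "'b measure" and r :: "'a \<Rightarrow> 'b \<Rightarrow> real"
  where "prob_space \<mu>" "sets \<mu> = sets Y" "\<And>a. r a \<in> borel_measurable \<mu>" "\<And>a y. 0 \<le> r a y"
    "\<And>a b y. r a y \<le> exp (\<alpha>\<^sub>0 * dist a b) * r b y" "\<And>a. A a = density \<mu> (\<lambda>y. ennreal (r a y))"
proof -
  have A': "prob_space (A x)" "sets (A x) = sets Y" for x
    using measurable_space[OF A, of x] by (auto simp: space_prob_algebra)
  define \<mu> where "\<mu> = A undefined"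
  interpret \<mu>: prob_space \<mu> unfolding \<mu>_def by (rule A')
  have sets: "sets \<mu> = sets Y" by (simp add: \<mu>_def A')
  have le: "emeasure (A a) S \<le> ennreal (exp (\<alpha>\<^sub>0 * dist a b)) * emeasure (A b) S" if "S \<in> sets Y" for a b S
  proof -
    interpret a: prob_space "A a" by (rule A')
    interpret b: prob_space "A b" by (rule A')
    have "measure (A a) S \<le> exp (\<alpha>\<^sub>0 * dist a b) * measure (A b) S"
      using DP that by (simp add: metric_DP_def)
    then show ?thesis
      by (simp add: a.emeasure_eq_measure b.emeasure_eq_measure flip: ennreal_mult)
  qed
  have "\<exists>f. f \<in> borel_measurable \<mu> \<and> density \<mu> f = A a" for a
  proof -
    have "absolutely_continuous \<mu> (A a)"
      unfolding absolutely_continuous_def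
    proof
      fix S assume "S \<in> null_sets \<mu>"
      then show "S \<in> null_sets (A a)"
        using le[of S a undefined] sets A'(2) by (auto simp: null_sets_def \<mu>_def)
    qed
    then show ?thesis using \<mu>.Radon_Nikodym[of "A a"] A' sets by auto
  qed
  then obtain f where f[measurable]: "\<And>a. f a \<in> borel_measurable \<mu>" and Af: "\<And>a. density \<mu> (f a) = A a"
    by metis
  have 1: "AE y in \<mu>. \<forall>a\<in>UNIV. \<forall>b\<in>UNIV. f a y \<le> ennreal (exp (\<alpha>\<^sub>0 * dist a b)) * f b y"
  proof (intro AE_finite_allI density_le_imp_AE_le)
    fix a b :: 'a
    let ?c = "ennreal (exp (\<alpha>\<^sub>0 * dist a b))"
    have d: "emeasure (density \<mu> (\<lambda>y. ?c * f b y)) S = ?c * emeasure (A b) S" if "S \<in> sets \<mu>" for S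
      using that by (simp add: emeasure_density mult.assoc nn_integral_cmult flip: Af)
    interpret b: prob_space "A b" by (rule A')
    show "finite_measure (density \<mu> (\<lambda>y. ?c * f b y))"
      using d[of "space \<mu>"] b.emeasure_finite by (intro finite_measureI) (auto simp: ennreal_mult_eq_top_iff)
    show "emeasure (density \<mu> (f a)) S \<le> emeasure (density \<mu> (\<lambda>y. ?c * f b y)) S" if "S \<in> sets \<mu>" for S
      using that le[of S a b] d[OF that] sets by (simp add: Af)
  qed auto
  have 2: "AE y in \<mu>. \<forall>a\<in>UNIV. f a y \<noteq> \<infinity>"
  proof (intro AE_finite_allI nn_integral_PInf_AE)
    fix a
    interpret a: prob_space "A a" by (rule A')
    show "(\<integral>\<^sup>+y. f a y \<partial>\<mu>) \<noteq> \<infinity>"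
      using a.emeasure_space_1 emeasure_density[OF f, of "space \<mu>" a] sets.top[of \<mu>]
      by (simp add: Af sets_eq_imp_space_eq[of "A a" \<mu>] sets A')
  qed auto
  define good where "good y \<longleftrightarrow> (\<forall>a b. f a y \<le> ennreal (exp (\<alpha>\<^sub>0 * dist a b)) * f b y) \<and> (\<forall>a. f a y \<noteq> \<infinity>)" for y
  have good: "AE y in \<mu>. good y" unfolding good_def using 1 2 by auto
  have [measurable]: "Measurable.pred \<mu> good"
    unfolding good_def by measurable
  define r where "r a y = (if good y then enn2real (f a y) else 0)" for a y
  show thesis
  proof (rule that[of \<mu> r])
    show "prob_space \<mu>" by unfold_locales
    show "sets \<mu> = sets Y" by (rule sets)
    show "r a \<in> borel_measurable \<mu>" for a unfolding r_def by measurable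
    show "0 \<le> r a y" for a y by (simp add: r_def)
    show "r a y \<le> exp (\<alpha>\<^sub>0 * dist a b) * r b y" for a b y
    proof (cases "good y")
      case True
      then have "enn2real (f a y) \<le> enn2real (ennreal (exp (\<alpha>\<^sub>0 * dist a b)) * f b y)"
        by (intro enn2real_mono) (auto simp: good_def less_top[symmetric] ennreal_mult_eq_top_iff)
      then show ?thesis using True by (simp add: r_def enn2real_mult)
    qed (simp add: r_def)
    show "A a = density \<mu> (\<lambda>y. ennreal (r a y))" for a
    proof -
      have "AE y in \<mu>. f a y = ennreal (r a y)"
        using good by eventually_elim (simp add: r_def good_def less_top)
      then have "density \<mu> (f a) = density \<mu> (\<lambda>y. ennreal (r a y))"
        by (intro density_cong) (auto simp: r_def)
      then show ?thesis by (simp add: Af)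
    qed
  qed
qed

lemma PiM_density:
  fixes g :: "'i \<Rightarrow> 'b \<Rightarrow> ennreal"
  assumes I: "finite I" and \<mu>: "prob_space \<mu>"
    and g[measurable]: "\<And>i. g i \<in> borel_measurable \<mu>"
    and d: "\<And>i. prob_space (density \<mu> (g i))"
  shows "(\<Pi>\<^sub>M i\<in>I. density \<mu> (g i)) = density (\<Pi>\<^sub>M i\<in>I. \<mu>) (\<lambda>y. \<Prod>i\<in>I. g i (y i))"
proof -
  interpret d: product_sigma_finite "\<lambda>i. density \<mu> (g i)"
    using d by (simp add: product_sigma_finite_def prob_space_imp_sigma_finite)
  interpret \<mu>: product_sigma_finite "\<lambda>_::'i. \<mu>"
    using \<mu> by (simp add: product_sigma_finite_def prob_space_imp_sigma_finite)
  show ?thesis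
  proof (rule d.PiM_eqI[symmetric])
    show "sets (density (\<Pi>\<^sub>M i\<in>I. \<mu>) (\<lambda>y. \<Prod>i\<in>I. g i (y i))) = sets (\<Pi>\<^sub>M i\<in>I. density \<mu> (g i))"
      by (auto intro!: sets_PiM_cong)
    fix S assume S: "\<And>i. i \<in> I \<Longrightarrow> S i \<in> sets (density \<mu> (g i))"
    have "emeasure (density (\<Pi>\<^sub>M i\<in>I. \<mu>) (\<lambda>y. \<Prod>i\<in>I. g i (y i))) (Pi\<^sub>E I S)
        = (\<integral>\<^sup>+y. (\<Prod>i\<in>I. g i (y i)) * indicator (Pi\<^sub>E I S) y \<partial>(\<Pi>\<^sub>M i\<in>I. \<mu>))"
      using S I by (intro emeasure_density sets_PiM_I_finite) auto
    also have "\<dots> = (\<integral>\<^sup>+y. (\<Prod>i\<in>I. g i (y i) * indicator (S i) (y i)) \<partial>(\<Pi>\<^sub>M i\<in>I. \<mu>))"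
    proof (rule nn_integral_cong)
      fix y assume "y \<in> space (\<Pi>\<^sub>M i\<in>I. \<mu>)"
      then have "indicator (Pi\<^sub>E I S) y = (\<Prod>i\<in>I. indicator (S i) (y i) :: ennreal)"
        using I by (auto simp: indicator_def space_PiM PiE_iff)
      then show "(\<Prod>i\<in>I. g i (y i)) * indicator (Pi\<^sub>E I S) y = (\<Prod>i\<in>I. g i (y i) * indicator (S i) (y i))"
        by (simp add: prod.distrib)
    qed
    also have "\<dots> = (\<Prod>i\<in>I. \<integral>\<^sup>+y. g i y * indicator (S i) y \<partial>\<mu>)"
      using S I by (intro \<mu>.product_nn_integral_prod) auto
    also have "\<dots> = (\<Prod>i\<in>I. emeasure (density \<mu> (g i)) (S i))"
      using S by (intro prod.cong) (auto simp: emeasure_density)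
    finally show "emeasure (density (\<Pi>\<^sub>M i\<in>I. \<mu>) (\<lambda>y. \<Prod>i\<in>I. g i (y i))) (Pi\<^sub>E I S)
        = (\<Prod>i\<in>I. emeasure (density \<mu> (g i)) (S i))" .
  qed (rule I)
qed

text \<open>Fubini, with the permutation in the inner integral: the integrand is the average over
  all orders, which becomes the symmetric test \<open>f\<close>.\<close>

lemma measure_shuffle_list:
  fixes A :: "'a \<Rightarrow> 'b measure"
  assumes A: "A \<in> count_space UNIV \<rightarrow>\<^sub>M prob_algebra Y"
    and S: "S \<in> sets (\<Pi>\<^sub>M i\<in>{..<length xs}. Y)"
  shows "measure (shuffle_list Y A xs) S
    = (\<integral>y. (\<Sum>\<sigma> | \<sigma> permutes {..<length xs}. indicator S (\<lambda>i\<in>{..<length xs}. y (\<sigma> i))) / fact (length xs)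
        \<partial>(\<Pi>\<^sub>M i\<in>{..<length xs}. A (xs ! i)))"
proof -
  define N where "N = length xs"
  have A': "prob_space (A x)" "sets (A x) = sets Y" for x
    using measurable_space[OF A, of x] by (auto simp: space_prob_algebra)
  let ?\<Sigma> = "{\<sigma>. \<sigma> permutes {..<N}}"
  let ?U = "uniform_count_measure ?\<Sigma>" and ?X = "\<Pi>\<^sub>M i\<in>{..<N}. A (xs ! i)"
  let ?F = "\<lambda>(\<sigma>, y). \<lambda>i\<in>{..<N}. y (\<sigma> i) :: 'b"
  have fin: "finite ?\<Sigma>" by (intro finite_permutations finite_lessThan)
  have card: "card ?\<Sigma> = fact N" using card_permutations[of "{..<N}" N] by simp
  interpret U: prob_space ?U
    using fin by (rule prob_space_uniform_count_measure) (auto intro: permutes_id)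
  interpret X: prob_space ?X by (intro prob_space_PiM A')
  interpret UX: pair_prob_space ?U ?X ..
  have F[measurable]: "?F \<in> ?U \<Otimes>\<^sub>M ?X \<rightarrow>\<^sub>M (\<Pi>\<^sub>M i\<in>{..<N}. Y)"
    by (rule measurable_reorder) (simp add: A')
  have S'[measurable]: "S \<in> sets (\<Pi>\<^sub>M i\<in>{..<N}. Y)" using S by (simp add: N_def)
  have "measure (shuffle_list Y A xs) S = (\<integral>z. indicator S z \<partial>shuffle_list Y A xs)"
    using S' by (simp add: shuffle_list_def Let_def N_def[symmetric])
  also have "\<dots> = (\<integral>z. indicator S (?F z) \<partial>(?U \<Otimes>\<^sub>M ?X))"
    unfolding shuffle_list_def Let_def N_def[symmetric] by (rule integral_distr) auto
  also have "\<dots> = (\<integral>y. (\<integral>\<sigma>. indicator S (?F (\<sigma>, y)) \<partial>?U) \<partial>?X)"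
  proof -
    let ?g = "\<lambda>\<sigma> y. indicator S (?F (\<sigma>, y)) :: real"
    have eq: "case_prod ?g = (\<lambda>z. indicator S (?F z))" by auto
    have "integrable (?U \<Otimes>\<^sub>M ?X) (case_prod ?g)"
      unfolding eq by (rule UX.P.integrable_const_bound[where B = 1]) auto
    from UX.integral_snd[OF this] show ?thesis unfolding eq by simp
  qed
  also have "\<dots> = (\<integral>y. (\<Sum>\<sigma>\<in>?\<Sigma>. indicator S (\<lambda>i\<in>{..<N}. y (\<sigma> i))) / fact N \<partial>?X)"
    using fin card by (simp add: integral_uniform_count_measure)
  finally show ?thesis by (simp add: N_def)
qed

section \<open>Replacing elements of a dataset\<close>

text \<open>Exchanging the weights changes the mixture by \<open>t * (E0 - E1)\<close> only, which
  reduces the gain \<open>B\<close> between the extremes to \<open>t * B\<close>. If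
  \<open>E1 \<le> E0\<close>, the last summand of the identity is nonnegative; otherwise the first
  summand outweighs it.\<close>

lemma mix_le_of_extreme_le:
  fixes t B \<eta> E0 E1 :: real
  assumes t: "0 \<le> t" "t \<le> 1" and B: "0 \<le> B" and E: "E0 \<le> (1 + B) * E1 + \<eta>"
    and nonneg: "0 \<le> E0" "0 \<le> E1" "0 \<le> \<eta>"
  shows "(1 + t) / 2 * E0 + (1 - t) / 2 * E1 \<le> (1 + t * B) * ((1 - t) / 2 * E0 + (1 + t) / 2 * E1) + \<eta>"
proof -
  have "(1 + t * B) * ((1 - t) / 2 * E0 + (1 + t) / 2 * E1) + \<eta> - ((1 + t) / 2 * E0 + (1 - t) / 2 * E1)
      = t * ((1 + B) * E1 - E0) + \<eta> + t * B * ((1 - t) / 2) * (E0 - E1)"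
  proof -
    define s where "s = (1 - t) / 2"
    then have 1: "(1 - t) / 2 = s" and 2: "(1 + t) / 2 = 1 - s" and 3: "t = 1 - 2 * s"
      by (auto simp: field_simps)
    show ?thesis unfolding 1 2 unfolding 3 by (simp add: algebra_simps)
  qed
  also have "\<dots> \<ge> 0"
  proof (cases "E1 \<le> E0")
    case True
    have "- \<eta> \<le> 1 * (- \<eta>)" by simp
    also have "\<dots> \<le> t * (- \<eta>)" using t nonneg by (intro mult_right_mono_neg) auto
    also have "\<dots> \<le> t * ((1 + B) * E1 - E0)" using t E by (intro mult_left_mono) auto
    finally have "0 \<le> t * ((1 + B) * E1 - E0) + \<eta>" by simp
    moreover have "0 \<le> t * B * ((1 - t) / 2) * (E0 - E1)"
      using True t B by (intro mult_nonneg_nonneg divide_nonneg_nonneg) auto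
    ultimately show ?thesis by linarith
  next
    case False
    have "t * B * ((1 - t) / 2) * (E1 - E0) \<le> t * B * 1 * (E1 - E0)"
      using False t B by (intro mult_right_mono mult_left_mono) auto
    also have "\<dots> \<le> t * B * E1"
      unfolding mult_1_right using t B nonneg by (intro mult_left_mono) (auto intro: mult_nonneg_nonneg)
    also have "\<dots> \<le> t * ((1 + B) * E1 - E0)"
      unfolding mult.assoc using False t by (intro mult_left_mono) (auto simp: algebra_simps)
    finally have "0 \<le> t * ((1 + B) * E1 - E0) - t * B * ((1 - t) / 2) * (E1 - E0)" by simp
    moreover have "t * B * ((1 - t) / 2) * (E1 - E0) = - (t * B * ((1 - t) / 2) * (E0 - E1))"
      by (simp only: minus_mult_right minus_diff_eq)
    ultimately show ?thesis using nonneg(3) by linarith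
  qed
  finally show ?thesis by simp
qed

locale private_densities = symmetric_test \<mu> N f
  for \<mu> :: "'b measure" and N and f +
  fixes r :: "'a::metric_space \<Rightarrow> 'b \<Rightarrow> real" and \<alpha>\<^sub>0 :: real
  assumes \<alpha>\<^sub>0: "0 \<le> \<alpha>\<^sub>0" and dist_le_1: "\<And>a b :: 'a. dist a b \<le> 1"
    and r_int: "\<And>a. integrable \<mu> (r a)" and r_nonneg: "\<And>a y. 0 \<le> r a y"
    and r_1: "\<And>a. (\<integral>y. r a y \<partial>\<mu>) = 1"
    and r_le: "\<And>a b y. r a y \<le> exp (\<alpha>\<^sub>0 * dist a b) * r b y"
begin

lemma \<Phi>_r_nonneg: "0 \<le> \<Phi> (\<lambda>i. r (x i))"
  by (intro \<Phi>_nonneg r_nonneg)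

text \<open>The bound without amplification, for the case \<open>B > 2\<close>: the ratio bounds
  multiply under the integral.\<close>

lemma replace_many_pure:
  assumes m: "m \<le> N" and x: "\<And>i. m \<le> i \<Longrightarrow> i < N \<Longrightarrow> x i = x' i"
  shows "\<Phi> (\<lambda>i. r (x i)) \<le> exp (\<alpha>\<^sub>0 * (\<Sum>i<m. dist (x i) (x' i))) * \<Phi> (\<lambda>i. r (x' i))"
proof (rule \<Phi>_mono)
  fix y :: "nat \<Rightarrow> 'b"
  have "(\<Prod>i<N. r (x i) (y i)) \<le> (\<Prod>i<N. exp (\<alpha>\<^sub>0 * dist (x i) (x' i)) * r (x' i) (y i))"
    by (intro prod_mono conjI r_nonneg r_le)
  also have "\<dots> = exp (\<alpha>\<^sub>0 * (\<Sum>i<N. dist (x i) (x' i))) * (\<Prod>i<N. r (x' i) (y i))"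
    by (simp add: prod.distrib exp_sum sum_distrib_left)
  also have "(\<Sum>i<N. dist (x i) (x' i)) = (\<Sum>i<m. dist (x i) (x' i))"
    using m x by (intro sum.mono_neutral_right) auto
  finally show "(\<Prod>i<N. r (x i) (y i))
      \<le> exp (\<alpha>\<^sub>0 * (\<Sum>i<m. dist (x i) (x' i))) * (\<Prod>i<N. r (x' i) (y i))" .
qed (auto intro: r_int)

text \<open>The densities \<open>r (x k)\<close> and \<open>r b\<close> are mixtures of probability densities \<open>q0\<close> and \<open>q1\<close> with
  weights \<open>(1 \<plusminus> t) / 2\<close>, and every other density dominates \<open>exp (- \<alpha>\<^sub>0) * (q0 + q1) / 2\<close>.\<close>

lemma replace_one:
  assumes k: "k < N" and L: "1 \<le> L" and B: "0 \<le> B" "B \<le> 2" "64 * L \<le> exp (- \<alpha>\<^sub>0) * N * B\<^sup>2"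
  shows "\<Phi> (\<lambda>i. r (x i)) \<le> amp B (\<alpha>\<^sub>0 * dist (x k) b) * \<Phi> (\<lambda>i. r ((x(k := b)) i)) + exp (- L)"
proof -
  define z where "z = \<alpha>\<^sub>0 * dist (x k) b"
  have z: "0 \<le> z" using \<alpha>\<^sub>0 by (simp add: z_def)
  show ?thesis
  \<comment> \<open>For \<open>z = 0\<close> the weight \<open>t\<close> vanishes and
    \<open>q0\<close>, \<open>q1\<close> would divide by 0; but then the two densities
    coincide.\<close>
  proof (cases "z = 0")
    case True
    have "\<Phi> (\<lambda>i. r (x i)) \<le> 1 * \<Phi> (\<lambda>i. r ((x(k := b)) i))"
    proof (rule \<Phi>_mono)
      fix y :: "nat \<Rightarrow> 'b"
      have "r (x i) (y i) \<le> r ((x(k := b)) i) (y i)" for i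
        using r_le[of "x k" "y k" b] True by (auto simp: z_def)
      then show "(\<Prod>i<N. r (x i) (y i)) \<le> 1 * (\<Prod>i<N. r ((x(k := b)) i) (y i))"
        by (simp only: mult_1, intro prod_mono conjI r_nonneg)
    qed (auto intro: r_int)
    then show ?thesis using True by (simp add: z_def[symmetric] add_increasing2)
  next
    case False
    \<comment> \<open>Chosen so that \<open>(1 + t) / (1 - t) = exp z\<close>, the extreme ratio
      allowed between the two densities; this makes \<open>q0\<close> and \<open>q1\<close>
      nonnegative.\<close>
    define t where "t = (exp z - 1) / (exp z + 1)"
    have ez: "1 < exp z" using z False by simp
    have ez1: "0 < exp z + 1" using ez by linarith
    then have t: "0 < t" "t < 1"
      unfolding t_def using ez by (simp_all add: pos_divide_less_eq del: one_less_exp_iff)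
    have "t * (exp z + 1) = exp z - 1" using ez1 by (simp add: t_def del: exp_gt_zero)
    then have te: "(1 - t) * exp z = 1 + t" by (simp add: algebra_simps)
    define p where "p = exp (- \<alpha>\<^sub>0)"
    have p: "0 < p" "p \<le> 1" using \<alpha>\<^sub>0 by (auto simp: p_def)
    let ?a = "r (x k)" and ?b = "r b"
    \<comment> \<open>The solution of the linear system that writes \<open>?a\<close> and
      \<open>?b\<close> as mixtures of \<open>q0\<close> and \<open>q1\<close> with weights
      \<open>(1 + t) / 2\<close> and \<open>(1 - t) / 2\<close>, in the two orders.\<close>
    define q0 where "q0 y = ((1 + t) / (2 * t)) * ?a y - ((1 - t) / (2 * t)) * ?b y" for y
    define q1 where "q1 y = ((1 + t) / (2 * t)) * ?b y - ((1 - t) / (2 * t)) * ?a y" for y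
    define l where "l i y = r (x i) y - p / 2 * (?a y + ?b y)" for i y
    have q_nonneg: "0 \<le> (1 + t) / (2 * t) * r c y - (1 - t) / (2 * t) * r d y"
      if "\<alpha>\<^sub>0 * dist d c = z" for c d y
    proof -
      have "(1 - t) * r d y \<le> (1 - t) * (exp z * r c y)"
        using r_le[of d y c] t that by (intro mult_left_mono) auto
      also have "\<dots> = (1 + t) * r c y" using te by (simp add: mult.assoc[symmetric])
      finally show ?thesis using t by (simp add: divide_simps)
    qed
    have q0_nonneg: "0 \<le> q0 y" and q1_nonneg: "0 \<le> q1 y" for y
      unfolding q0_def q1_def by (intro q_nonneg; simp add: z_def dist_commute)+
    \<comment> \<open>The coefficients do not involve \<open>t\<close>: the clone probability is
      governed by \<open>\<alpha>\<^sub>0\<close> alone, and the same \<open>B\<close> serves all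
      distances.\<close>
    have q_sum: "q0 y + q1 y = ?a y + ?b y" for y
      using t by (simp add: q0_def q1_def field_simps)
    have q_int: "integrable \<mu> q0" "integrable \<mu> q1"
      unfolding q0_def q1_def using r_int by auto
    have q_1: "(\<integral>y. q0 y \<partial>\<mu>) = 1" "(\<integral>y. q1 y \<partial>\<mu>) = 1"
      unfolding q0_def q1_def using r_int t by (simp_all add: r_1 field_simps)
    have l_int: "integrable \<mu> (l i)" for i unfolding l_def using r_int by auto
    have l_1: "(\<integral>y. l i y \<partial>\<mu>) = 1 - p" for i
      unfolding l_def using r_int by (simp add: r_1)
    have p_le: "p * r c y \<le> r d y" for c d y
    proof -
      have "r c y \<le> exp (\<alpha>\<^sub>0 * dist c d) * r d y" by (rule r_le)
      also have "\<dots> \<le> exp \<alpha>\<^sub>0 * r d y"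
        using \<alpha>\<^sub>0 dist_le_1[of c d] r_nonneg by (intro mult_right_mono) (auto simp: mult_left_le)
      finally have "r c y \<le> exp \<alpha>\<^sub>0 * r d y" .
      then have "p * r c y \<le> p * (exp \<alpha>\<^sub>0 * r d y)" using p by (intro mult_left_mono) auto
      also have "p * (exp \<alpha>\<^sub>0 * r d y) = r d y" by (simp add: p_def exp_minus)
      finally show ?thesis .
    qed
    have l_nonneg: "0 \<le> l i y" for i y
      using p_le[of "x k" y "x i"] p_le[of b y "x i"] by (simp add: l_def algebra_simps)
    define G where "G i = r (x i)" for i
    have E: "\<Phi> (G(k := q0)) \<le> (1 + B) * \<Phi> (G(k := q1)) + exp (- L)"
    proof (rule clone_bound[where l = l and p = p and \<theta> = "B / 11"])
      show "G i y = p / 2 * q0 y + p / 2 * q1 y + l i y" for i y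
        unfolding distrib_left[symmetric] q_sum by (simp add: G_def l_def)
      show "exp (B / 11) * (p / 2 * exp (B / 11) + p / 2 * exp (- (B / 11) * (1 + B)) + (1 - p)) ^ (N - 1)
          \<le> exp (- L)"
        using p L B by (intro clone_chernoff_bound) (auto simp: p_def)
    qed (use k q_int q0_nonneg q1_nonneg q_1 l_int l_nonneg l_1 p B in auto)
    have lin: "\<Phi> (G(k := \<lambda>y. c * q0 y + d * q1 y)) = c * \<Phi> (G(k := q0)) + d * \<Phi> (G(k := q1))" for c d
      using k q_int r_int by (intro \<Phi>_linear) (auto simp: G_def)
    have "?a = (\<lambda>y. (1 + t) / 2 * q0 y + (1 - t) / 2 * q1 y)"
      using t by (simp add: fun_eq_iff q0_def q1_def field_simps)
    then have "(\<lambda>i. r (x i)) = G(k := \<lambda>y. (1 + t) / 2 * q0 y + (1 - t) / 2 * q1 y)"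
      by (auto simp: G_def)
    then have 1: "\<Phi> (\<lambda>i. r (x i)) = (1 + t) / 2 * \<Phi> (G(k := q0)) + (1 - t) / 2 * \<Phi> (G(k := q1))"
      by (simp only: lin)
    have "?b = (\<lambda>y. (1 - t) / 2 * q0 y + (1 + t) / 2 * q1 y)"
      using t by (simp add: fun_eq_iff q0_def q1_def field_simps)
    then have "(\<lambda>i. r ((x(k := b)) i)) = G(k := \<lambda>y. (1 - t) / 2 * q0 y + (1 + t) / 2 * q1 y)"
      by (auto simp: G_def)
    then have 2: "\<Phi> (\<lambda>i. r ((x(k := b)) i)) = (1 - t) / 2 * \<Phi> (G(k := q0)) + (1 + t) / 2 * \<Phi> (G(k := q1))"
      by (simp only: lin)
    have "0 \<le> \<Phi> (G(k := q0))" "0 \<le> \<Phi> (G(k := q1))"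
      by (intro \<Phi>_nonneg; simp add: G_def r_nonneg q0_nonneg q1_nonneg)+
    then show ?thesis
      using mix_le_of_extreme_le[OF _ _ B(1) E, of t] t
      unfolding 1 2 by (simp add: amp_def t_def z_def)
  qed
qed

text \<open>A hybrid argument along the datasets \<open>z j\<close> with the first \<open>j\<close>
  elements replaced. Each error gets multiplied by the factors of the preceding steps, at most
  \<open>amp B \<alpha>\<^sub>0\<close> each since distances are at most 1.\<close>

lemma replace_many:
  assumes m: "m \<le> N" and x: "\<And>i. m \<le> i \<Longrightarrow> i < N \<Longrightarrow> x i = x' i"
    and L: "1 \<le> L" and B: "0 \<le> B" "B \<le> 2" "64 * L \<le> exp (- \<alpha>\<^sub>0) * N * B\<^sup>2"
  shows "\<Phi> (\<lambda>i. r (x i)) \<le> (\<Prod>i<m. amp B (\<alpha>\<^sub>0 * dist (x i) (x' i))) * \<Phi> (\<lambda>i. r (x' i))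
    + m * exp (- L) * amp B \<alpha>\<^sub>0 ^ m"
proof -
  define c where "c i = amp B (\<alpha>\<^sub>0 * dist (x i) (x' i))" for i
  define C where "C = amp B \<alpha>\<^sub>0"
  define z where "z j i = (if i < j then x' i else x i)" for i j :: nat
  have C1: "1 \<le> C" unfolding C_def using B \<alpha>\<^sub>0 by (intro amp_ge_1)
  have c0: "0 \<le> c i" for i
    using amp_ge_1[OF B(1), of "\<alpha>\<^sub>0 * dist (x i) (x' i)"] \<alpha>\<^sub>0 by (simp add: c_def)
  have cC: "c i \<le> C" for i
    unfolding c_def C_def using \<alpha>\<^sub>0 dist_le_1 by (intro amp_mono B) (auto simp: mult_left_le)
  have "\<Phi> (\<lambda>i. r (x i)) \<le> (\<Prod>i<j. c i) * \<Phi> (\<lambda>i. r (z j i)) + j * exp (- L) * C ^ j" if "j \<le> m" for j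
    using that
  proof (induction j)
    case (Suc j)
    have "\<Phi> (\<lambda>i. r (x i)) \<le> (\<Prod>i<j. c i) * \<Phi> (\<lambda>i. r (z j i)) + j * exp (- L) * C ^ j"
      using Suc by simp
    also have "\<Phi> (\<lambda>i. r (z j i)) \<le> c j * \<Phi> (\<lambda>i. r (z (Suc j) i)) + exp (- L)"
    proof -
      have "(z j)(j := x' j) = z (Suc j)" by (auto simp: z_def fun_eq_iff less_Suc_eq)
      moreover have "z j j = x j" by (simp add: z_def)
      ultimately show ?thesis
        using replace_one[of j L B "z j" "x' j"] Suc.prems m L B by (simp add: c_def)
    qed
    finally have "\<Phi> (\<lambda>i. r (x i)) \<le> (\<Prod>i<j. c i) * (c j * \<Phi> (\<lambda>i. r (z (Suc j) i)) + exp (- L))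
        + j * exp (- L) * C ^ j"
      by (auto intro!: mult_left_mono prod_nonneg c0)
    also have "\<dots> = (\<Prod>i<Suc j. c i) * \<Phi> (\<lambda>i. r (z (Suc j) i)) + ((\<Prod>i<j. c i) * exp (- L)
        + j * exp (- L) * C ^ j)"
      by (simp add: algebra_simps)
    also have "(\<Prod>i<j. c i) * exp (- L) + j * exp (- L) * C ^ j \<le> Suc j * exp (- L) * C ^ Suc j"
    proof -
      have "(\<Prod>i<j. c i) \<le> C ^ j" using prod_mono[of "{..<j}" c "\<lambda>_. C"] c0 cC by simp
      then have "(\<Prod>i<j. c i) * exp (- L) + j * exp (- L) * C ^ j \<le> Suc j * exp (- L) * C ^ j"
        by (simp add: algebra_simps)
      also have "\<dots> \<le> Suc j * exp (- L) * C ^ Suc j"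
        using C1 by (intro mult_left_mono power_increasing) auto
      finally show ?thesis .
    qed
    finally show ?case by simp
  qed (simp add: z_def)
  from this[of m] have "\<Phi> (\<lambda>i. r (x i)) \<le> (\<Prod>i<m. c i) * \<Phi> (\<lambda>i. r (z m i)) + m * exp (- L) * C ^ m"
    by simp
  also have "\<Phi> (\<lambda>i. r (z m i)) = \<Phi> (\<lambda>i. r (x' i))"
    unfolding \<Phi>_def using x
    by (intro Bochner_Integration.integral_cong refl arg_cong2[where f = "(*)"] prod.cong) (auto simp: z_def)
  finally show ?thesis by (simp add: c_def C_def)
qed

end

section \<open>From replacements to the privacy of the mechanism\<close>

lemma h_bound_eq_ln_amp:
  assumes "m \<ge> 1"
  shows "h_bound \<alpha>\<^sub>0 \<delta> M (real m) (real m * w)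
    = m * ln (amp (8 * sqrt (exp \<alpha>\<^sub>0 * ln (4 * real m / \<delta>)) / sqrt M + 8 * exp \<alpha>\<^sub>0 / M) (\<alpha>\<^sub>0 * w))"
  using assms by (simp add: h_bound_def amp_def)

lemma shuffle_list_replace_many:
  fixes A :: "'a::{finite,metric_space} \<Rightarrow> 'b measure" and xs ys :: "'a list" and \<delta> \<alpha>\<^sub>0 :: real
  assumes dist1: "\<And>a b :: 'a. dist a b \<le> 1"
    and A: "A \<in> count_space UNIV \<rightarrow>\<^sub>M prob_algebra Y" and DP: "metric_DP \<alpha>\<^sub>0 0 Y A"
    and \<alpha>\<^sub>0: "0 \<le> \<alpha>\<^sub>0" and \<delta>: "0 < \<delta>" "\<delta> < 1" and m: "1 \<le> m" "m \<le> N"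
    and len: "length xs = N" "length ys = N"
    and xs: "\<And>i. m \<le> i \<Longrightarrow> i < N \<Longrightarrow> xs ! i = ys ! i"
    and w: "w = (\<Sum>i<m. dist (xs ! i) (ys ! i)) / m"
    and \<alpha>: "\<And>w :: real. 0 < w \<Longrightarrow> w \<le> 1 \<Longrightarrow> h_bound \<alpha>\<^sub>0 \<delta> N m (m * w) / w \<le> \<alpha>"
    and S: "S \<in> sets (\<Pi>\<^sub>M i\<in>{..<N}. Y)"
  shows "measure (shuffle_list Y A xs) S
    \<le> exp (\<alpha> * w) * measure (shuffle_list Y A ys) S + \<delta> * exp (h_bound \<alpha>\<^sub>0 \<delta> N m m)"
proof -
  obtain \<mu> r where \<mu>: "prob_space \<mu>" "sets \<mu> = sets Y"
    and r_meas[measurable]: "\<And>a. r a \<in> borel_measurable \<mu>" and r_nonneg: "\<And>a y. 0 \<le> r a y"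
    and r_le: "\<And>a b y. r a y \<le> exp (\<alpha>\<^sub>0 * dist a b) * r b y"
    and A_eq: "\<And>a. A a = density \<mu> (\<lambda>y. ennreal (r a y))"
    using metric_DP_densities[OF A DP] by metis
  have A': "prob_space (A x)" for x
    using measurable_space[OF A, of x] by (auto simp: space_prob_algebra)
  have nn1: "(\<integral>\<^sup>+y. ennreal (r a y) \<partial>\<mu>) = 1" for a
    using prob_space.emeasure_space_1[OF A'[of a]] by (simp add: A_eq emeasure_density cong: nn_integral_cong)
  have r_int: "integrable \<mu> (r a)" for a
    using nn1[of a] r_nonneg by (intro integrableI_nonneg) auto
  have r_1: "(\<integral>y. r a y \<partial>\<mu>) = 1" for a
    using nn1[of a] r_nonneg by (simp add: integral_eq_nn_integral)
  define f :: "(nat \<Rightarrow> 'b) \<Rightarrow> real" where "f y = (\<Sum>\<sigma> | \<sigma> permutes {..<N}. indicator S (\<lambda>i\<in>{..<N}. y (\<sigma> i))) / fact N"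
    for y
  let ?\<Sigma> = "{\<sigma>. \<sigma> permutes {..<N}}"
  have card: "card ?\<Sigma> = fact N" using card_permutations[of "{..<N}" N] by simp
  have sets: "sets (\<Pi>\<^sub>M i\<in>{..<N}. \<mu>) = sets (\<Pi>\<^sub>M i\<in>{..<N}. Y)"
    using \<mu> by (intro sets_PiM_cong) auto
  interpret private_densities \<mu> N f r \<alpha>\<^sub>0
  proof (intro private_densities.intro symmetric_test.intro symmetric_test_axioms.intro
      private_densities_axioms.intro)
    show "f \<in> borel_measurable (\<Pi>\<^sub>M i\<in>{..<N}. \<mu>)"
      unfolding f_def
    proof (intro borel_measurable_divide borel_measurable_sum borel_measurable_const)
      fix \<sigma> assume "\<sigma> \<in> ?\<Sigma>"
      then have \<sigma>: "\<sigma> permutes {..<N}" by simp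
      have r: "(\<lambda>y. \<lambda>i\<in>{..<N}. y (\<sigma> i)) \<in> (\<Pi>\<^sub>M i\<in>{..<N}. \<mu>) \<rightarrow>\<^sub>M (\<Pi>\<^sub>M i\<in>{..<N}. \<mu>)"
        using permutes_in_image[OF \<sigma>] by (auto intro!: measurable_restrict measurable_component_singleton)
      show "(\<lambda>y. indicator S (\<lambda>i\<in>{..<N}. y (\<sigma> i)) :: real) \<in> borel_measurable (\<Pi>\<^sub>M i\<in>{..<N}. \<mu>)"
        using S sets by (intro measurable_compose[OF r borel_measurable_indicator]) auto
    qed
    show "0 \<le> f y" for y by (simp add: f_def sum_nonneg)
    have "(\<Sum>\<sigma>\<in>?\<Sigma>. indicator S (\<lambda>i\<in>{..<N}. y (\<sigma> i))) \<le> (\<Sum>\<sigma>\<in>?\<Sigma>. 1 :: real)" for y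
      by (intro sum_mono) (simp add: indicator_def)
    then show "f y \<le> 1" for y by (simp add: f_def card pos_divide_le_eq)
    \<comment> \<open>Composition with \<open>\<tau>\<close> only permutes the summands of the
      average.\<close>
    fix \<tau> y assume \<tau>: "\<tau> permutes {..<N}"
    have "f (\<lambda>i\<in>{..<N}. y (\<tau> i)) = (\<Sum>\<sigma>\<in>?\<Sigma>. indicator S (\<lambda>i\<in>{..<N}. y ((\<tau> \<circ> \<sigma>) i))) / fact N"
      unfolding f_def
    proof (intro arg_cong2[where f = "(/)"] sum.cong refl arg_cong2[where f = indicator] restrict_ext)
      fix \<sigma> i assume "\<sigma> \<in> ?\<Sigma>" "i \<in> {..<N}"
      then have "\<sigma> i \<in> {..<N}" using permutes_in_image by fastforce
      then show "(\<lambda>i\<in>{..<N}. y (\<tau> i)) (\<sigma> i) = y ((\<tau> \<circ> \<sigma>) i)" by simp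
    qed
    also have "\<dots> = f y"
    proof -
      have "bij_betw (\<lambda>\<sigma>. \<tau> \<circ> \<sigma>) ?\<Sigma> ?\<Sigma>"
        using \<tau> by (intro bij_betw_byWitness[where f' = "\<lambda>\<sigma>. inv \<tau> \<circ> \<sigma>"])
          (auto simp: o_assoc permutes_inv_o intro: permutes_compose permutes_inv)
      from sum.reindex_bij_betw[OF this, of "\<lambda>\<sigma>. indicator S (\<lambda>i\<in>{..<N}. y (\<sigma> i)) :: real"]
      show ?thesis by (simp add: f_def)
    qed
    finally show "f (\<lambda>i\<in>{..<N}. y (\<tau> i)) = f y" .
  qed (fact \<mu> \<alpha>\<^sub>0 dist1 r_int r_nonneg r_1 r_le)+
  have measure_eq: "measure (shuffle_list Y A zs) S = \<Phi> (\<lambda>i. r (zs ! i))" if "length zs = N" for zs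
  proof -
    have "measure (shuffle_list Y A zs) S = (\<integral>y. f y \<partial>(\<Pi>\<^sub>M i\<in>{..<N}. A (zs ! i)))"
      using measure_shuffle_list[OF A, of S zs] S that by (simp add: f_def)
    also have "(\<Pi>\<^sub>M i\<in>{..<N}. A (zs ! i)) = density (\<Pi>\<^sub>M i\<in>{..<N}. \<mu>) (\<lambda>y. \<Prod>i<N. ennreal (r (zs ! i) (y i)))"
      unfolding A_eq using A' by (intro PiM_density \<mu>) (auto simp: A_eq[symmetric])
    also have "\<dots> = density (\<Pi>\<^sub>M i\<in>{..<N}. \<mu>) (\<lambda>y. ennreal (\<Prod>i<N. r (zs ! i) (y i)))"
      using r_nonneg by (simp add: prod_ennreal)
    also have "(\<integral>y. f y \<partial>\<dots>) = \<Phi> (\<lambda>i. r (zs ! i))"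
      unfolding \<Phi>_def using f_meas r_nonneg
      by (subst integral_density) (auto simp: mult.commute intro!: prod_nonneg)
    finally show ?thesis .
  qed
  have d: "(\<Sum>i<m. dist (xs ! i) (ys ! i)) = m * w" using m by (simp add: w)
  have "(\<Sum>i<m. dist (xs ! i) (ys ! i)) \<le> (\<Sum>i<m. 1)" by (intro sum_mono dist1)
  then have w01: "0 \<le> w" "w \<le> 1" using m by (auto simp: w pos_divide_le_eq intro!: divide_nonneg_nonneg sum_nonneg)
  define B where "B = 8 * sqrt (exp \<alpha>\<^sub>0 * ln (4 * real m / \<delta>)) / sqrt N + 8 * exp \<alpha>\<^sub>0 / N"
  define L where "L = ln (4 * real m / \<delta>)"
  have N: "0 < real N" using m by simp
  have h: "h_bound \<alpha>\<^sub>0 \<delta> N m (m * w) = m * ln (amp B (\<alpha>\<^sub>0 * w))" for w :: real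
    unfolding B_def by (rule h_bound_eq_ln_amp[OF m(1)])
  \<comment> \<open>The 4 in \<open>ln (4 * m / \<delta>)\<close> yields \<open>L \<ge> 1\<close>,
    on which the Chernoff bound relies.\<close>
  have "exp 1 \<le> (4 :: real)" using exp_le by simp
  also have "\<dots> \<le> 4 * m / \<delta>" using m \<delta> by (simp add: pos_le_divide_eq)
  finally have L: "1 \<le> L" unfolding L_def using m \<delta> by (subst ln_ge_iff) auto
  have B_ge: "8 * sqrt (exp \<alpha>\<^sub>0 * L / N) \<le> B" "0 \<le> 8 * sqrt (exp \<alpha>\<^sub>0 * L / N)"
    using L by (auto simp: B_def L_def real_sqrt_divide)
  have "(8 * sqrt (exp \<alpha>\<^sub>0 * L / N))\<^sup>2 \<le> B\<^sup>2" using B_ge by (intro power_mono)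
  then have "64 * (exp \<alpha>\<^sub>0 * L / N) \<le> B\<^sup>2" using L by (simp add: power_mult_distrib)
  then have "exp (- \<alpha>\<^sub>0) * N * (64 * (exp \<alpha>\<^sub>0 * L / N)) \<le> exp (- \<alpha>\<^sub>0) * N * B\<^sup>2"
    by (intro mult_left_mono) auto
  then have B64: "64 * L \<le> exp (- \<alpha>\<^sub>0) * N * B\<^sup>2" using N by (simp add: exp_minus field_simps)
  have B0: "0 \<le> B" using B_ge by linarith
  let ?E = "\<Phi> (\<lambda>i. r (ys ! i))"
  have E0: "0 \<le> ?E" by (rule \<Phi>_r_nonneg)
  have "\<Phi> (\<lambda>i. r (xs ! i)) \<le> exp (\<alpha> * w) * ?E + \<delta> * exp (h_bound \<alpha>\<^sub>0 \<delta> N m m)"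
  proof (cases "B \<le> 2")
    case True
    have "\<Phi> (\<lambda>i. r (xs ! i)) \<le> (\<Prod>i<m. amp B (\<alpha>\<^sub>0 * dist (xs ! i) (ys ! i))) * ?E
        + m * exp (- L) * amp B \<alpha>\<^sub>0 ^ m"
      using m xs L B0 True B64 by (intro replace_many) auto
    also have "(\<Prod>i<m. amp B (\<alpha>\<^sub>0 * dist (xs ! i) (ys ! i))) \<le> exp (\<alpha> * w)"
    proof -
      have "(\<Prod>i<m. amp B (\<alpha>\<^sub>0 * dist (xs ! i) (ys ! i)))
          \<le> exp (m * ln (amp B ((\<Sum>i<m. \<alpha>\<^sub>0 * dist (xs ! i) (ys ! i)) / m)))"
        using m B0 \<alpha>\<^sub>0 by (intro prod_amp_le) auto
      also have "(\<Sum>i<m. \<alpha>\<^sub>0 * dist (xs ! i) (ys ! i)) / m = \<alpha>\<^sub>0 * w"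
        using m by (simp add: w sum_distrib_left)
      also have "m * ln (amp B (\<alpha>\<^sub>0 * w)) \<le> \<alpha> * w"
      \<comment> \<open>The supremum runs over \<open>w > 0\<close>; for \<open>w = 0\<close> both
        sides are 0.\<close>
      proof (cases "w = 0")
        case False
        then show ?thesis using \<alpha>[of w] w01 by (simp add: h pos_divide_le_eq)
      qed simp
      finally show ?thesis by simp
    qed
    also have "m * exp (- L) * amp B \<alpha>\<^sub>0 ^ m \<le> \<delta> * exp (h_bound \<alpha>\<^sub>0 \<delta> N m m)"
    proof -
      have "0 < amp B \<alpha>\<^sub>0" using amp_ge_1[OF B0 \<alpha>\<^sub>0] by linarith
      then have "amp B \<alpha>\<^sub>0 ^ m = exp (h_bound \<alpha>\<^sub>0 \<delta> N m m)"
        using h[of 1] by (simp add: exp_of_nat_mult)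
      moreover have "m * exp (- L) \<le> \<delta>"
        using m \<delta> by (simp add: L_def exp_minus)
      ultimately show ?thesis by (simp add: mult_right_mono)
    qed
    finally show ?thesis using E0 by (simp add: mult_right_mono)
  next
    case False
    have "real m * \<alpha>\<^sub>0 \<le> \<alpha>"
      using False \<alpha> \<alpha>\<^sub>0 by (intro sup_amp_ge_linear[of B]) (auto simp: h)
    then have "real m * \<alpha>\<^sub>0 * w \<le> \<alpha> * w" using w01(1) by (intro mult_right_mono)
    then have "\<alpha>\<^sub>0 * (m * w) \<le> \<alpha> * w" by (simp add: mult_ac)
    have "\<Phi> (\<lambda>i. r (xs ! i)) \<le> exp (\<alpha>\<^sub>0 * (m * w)) * ?E"
      using replace_many_pure[OF m(2), of "\<lambda>i. xs ! i" "\<lambda>i. ys ! i"] xs by (simp add: d)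
    also have "\<dots> \<le> exp (\<alpha> * w) * ?E"
      using \<open>\<alpha>\<^sub>0 * (m * w) \<le> \<alpha> * w\<close> E0 by (intro mult_right_mono) auto
    finally show ?thesis using \<delta> by (simp add: add_increasing2)
  qed
  then show ?thesis using len by (simp add: measure_eq)
qed

text \<open>Covers both models: \<open>R\<close> holds the items that stay, none in the local model
  and those of the other users in the central one.\<close>

lemma shuffle_mechanism_replace_many:
  fixes A :: "'a::{finite,metric_space} \<Rightarrow> 'b measure" and K K' R :: "'a multiset" and \<delta> \<alpha>\<^sub>0 :: real
  assumes dist1: "\<And>a b :: 'a. dist a b \<le> 1"
    and A: "A \<in> count_space UNIV \<rightarrow>\<^sub>M prob_algebra Y" and DP: "metric_DP \<alpha>\<^sub>0 0 Y A"
    and \<delta>: "0 < \<delta>" "\<delta> < 1" and m: "1 \<le> m"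
    and K: "size K = m" "size K' = m" and N: "N = m + size R"
    and S: "S \<in> sets (\<Pi>\<^sub>M i\<in>{..<N}. Y)"
  shows "measure (shuffle_mechanism Y A (K + R)) S
    \<le> exp ((SUP w\<in>{0<..1::real}. h_bound \<alpha>\<^sub>0 \<delta> N m (m * w) / w)
          * earth_mover_dist (pmf_of_multiset K) (pmf_of_multiset K'))
        * measure (shuffle_mechanism Y A (K' + R)) S
      + \<delta> * exp (h_bound \<alpha>\<^sub>0 \<delta> N m m)"
proof -
  let ?\<alpha> = "SUP w\<in>{0<..1::real}. h_bound \<alpha>\<^sub>0 \<delta> N m (m * w) / w"
  let ?d = "earth_mover_dist (pmf_of_multiset K) (pmf_of_multiset K')"
  obtain xs ys zs where l: "K = mset xs" "K' = mset ys" "R = mset zs"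
    using ex_mset by metis
  have len: "length xs = m" "length ys = m" using K l by auto
  define cost where "cost \<sigma> = (\<Sum>i<m. dist (xs ! i) (ys ! \<sigma> i))" for \<sigma>
  have fin: "finite {\<sigma>. \<sigma> permutes {..<m}}" by (intro finite_permutations finite_lessThan)
  moreover have "{\<sigma>. \<sigma> permutes {..<m}} \<noteq> {}" using permutes_id by blast
  ultimately obtain \<sigma> where \<sigma>: "\<sigma> permutes {..<m}" and min: "\<And>\<tau>. \<tau> permutes {..<m} \<Longrightarrow> cost \<sigma> \<le> cost \<tau>"
    using ex_min_if_finite[of "cost ` {\<sigma>. \<sigma> permutes {..<m}}"] by (fastforce simp: not_less)
  \<comment> \<open>Rearranging one enumeration leaves the mechanism unchanged and aligns the
    optimally matched elements position by position.\<close>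
  define ys' where "ys' = permute_list \<sigma> ys"
  have ys': "mset ys' = K'" "length ys' = m" using \<sigma> len l by (auto simp: ys'_def mset_permute_list)
  have ys'_nth: "ys' ! i = ys ! \<sigma> i" if "i < m" for i
    using that \<sigma> len by (simp add: ys'_def permute_list_nth)
  define w where "w = cost \<sigma> / m"
  have w_le: "w \<le> ?d"
    unfolding w_def l using len m min by (intro earth_mover_dist_ge) (auto simp: cost_def)
  have w0: "0 \<le> w" by (simp add: w_def cost_def sum_nonneg)
  show ?thesis
  proof (cases "0 \<le> \<alpha>\<^sub>0")
    case True
    have bdd: "bdd_above ((\<lambda>w :: real. h_bound \<alpha>\<^sub>0 \<delta> N m (m * w) / w) ` {0<..1})"
      using True \<delta> m N by (intro bdd_above_h_bound) auto
    have \<alpha>: "h_bound \<alpha>\<^sub>0 \<delta> N m (m * w) / w \<le> ?\<alpha>" if "0 < w" "w \<le> 1" for w :: real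
      using that by (intro cSUP_upper[OF _ bdd]) auto
    \<comment> \<open>Nonnegativity of the supremum, witnessed at \<open>w = 1\<close>, allows the
      matching cost to be replaced by the larger distance in the exponent.\<close>
    have "0 \<le> h_bound \<alpha>\<^sub>0 \<delta> N m (real m * 1) / 1"
    proof -
      have "1 \<le> 4 * m / \<delta>" using m \<delta> by (simp add: pos_le_divide_eq)
      then have "0 \<le> ln (4 * m / \<delta>)" by simp
      then show ?thesis
        unfolding h_bound_eq_ln_amp[OF m] using True
        by (auto intro!: mult_nonneg_nonneg ln_ge_zero amp_ge_1 add_nonneg_nonneg)
    qed
    also have "\<dots> \<le> ?\<alpha>" by (intro \<alpha>) auto
    finally have \<alpha>0: "0 \<le> ?\<alpha>" .
    have "measure (shuffle_list Y A (xs @ zs)) S \<le> exp (?\<alpha> * w) * measure (shuffle_list Y A (ys' @ zs)) S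
        + \<delta> * exp (h_bound \<alpha>\<^sub>0 \<delta> N m m)"
    proof (rule shuffle_list_replace_many[OF dist1 A DP True \<delta> m _ _ _ _ _ \<alpha> S])
      show "w = (\<Sum>i<m. dist ((xs @ zs) ! i) ((ys' @ zs) ! i)) / m"
        using len ys' by (simp add: w_def cost_def nth_append ys'_nth)
    qed (use N len ys' l in \<open>auto simp: nth_append\<close>)
    also have "exp (?\<alpha> * w) * measure (shuffle_list Y A (ys' @ zs)) S
        \<le> exp (?\<alpha> * ?d) * measure (shuffle_list Y A (ys' @ zs)) S"
      using w_le \<alpha>0 by (intro mult_right_mono) (auto intro: mult_left_mono)
    finally show ?thesis
      using ys' l by (simp add: shuffle_mechanism_mset[OF A, symmetric])
  next
    \<comment> \<open>With a negative \<open>\<alpha>\<^sub>0\<close>, comparing total masses forces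
      all points to coincide. Then \<open>K = K'\<close> and their distance is 0.\<close>
    case False
    have "a = b" for a b :: 'a
    proof (rule ccontr)
      assume "a \<noteq> b"
      have Y: "prob_space (A x)" "sets (A x) = sets Y" for x
        using measurable_space[OF A, of x] by (auto simp: space_prob_algebra)
      have "space Y = space (A x)" for x using Y(2) by (metis sets_eq_imp_space_eq)
      then have "measure (A x) (space Y) = 1" for x using prob_space.prob_space[OF Y(1)] by simp
      moreover have "measure (A a) (space Y) \<le> exp (\<alpha>\<^sub>0 * dist a b) * measure (A b) (space Y)"
        using DP unfolding metric_DP_def by (metis add_0_right sets.top)
      ultimately have "0 \<le> \<alpha>\<^sub>0 * dist a b" by simp
      then show False using False \<open>a \<noteq> b\<close> by (simp add: zero_le_mult_iff)
    qed
    then have dist0: "dist a b = 0" for a b :: 'a by simp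
    have "K = K'"
    proof -
      have "xs = ys" using len \<open>\<And>a b :: 'a. a = b\<close> by (intro nth_equalityI) auto
      then show ?thesis using l by simp
    qed
    moreover have "?d = 0"
    proof -
      have "pair_pmf (pmf_of_multiset K) (pmf_of_multiset K') \<in> couplings (pmf_of_multiset K) (pmf_of_multiset K')"
        by (simp add: couplings_def map_fst_pair_pmf map_snd_pair_pmf)
      then have "couplings (pmf_of_multiset K) (pmf_of_multiset K') \<noteq> {}" by blast
      moreover have "(\<lambda>(x, x'). dist x x') = (\<lambda>_ :: 'a \<times> 'a. 0 :: real)"
        by (auto simp only: fun_eq_iff dist0 split: prod.splits)
      ultimately show ?thesis unfolding earth_mover_dist_def by simp
    qed
    ultimately show ?thesis using \<delta> by simp
  qed
qed

theorem theorem4p4: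
  fixes A :: "'a::{finite,metric_space} \<Rightarrow> 'b measure"
    and Y :: "'b measure"
    and \<alpha>\<^sub>0 \<delta> :: real
    and m n :: nat
  assumes "\<And>x x' :: 'a. dist x x' \<le> 1"
    and "A \<in> count_space UNIV \<rightarrow>\<^sub>M prob_algebra Y"
    and "metric_DP \<alpha>\<^sub>0 0 Y A"
    and "0 < \<delta>" and "\<delta> < 1"
    and "m \<ge> 1" and "n \<ge> 1"
  shows "bounded_local_EM_DP m
           (SUP w\<in>{0<..1}. h_bound \<alpha>\<^sub>0 \<delta> (real m) (real m) (real m * w) / w)
           (\<delta> * exp (h_bound \<alpha>\<^sub>0 \<delta> (real m) (real m) (real m)))
           (\<Pi>\<^sub>M i\<in>{..<m}. Y) (shuffle_mechanism Y A)
       \<and> bounded_central_EM_DP n m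
           (SUP w\<in>{0<..1}. h_bound \<alpha>\<^sub>0 \<delta> (real (m * n)) (real m) (real m * w) / w)
           (\<delta> * exp (h_bound \<alpha>\<^sub>0 \<delta> (real (m * n)) (real m) (real m)))
           (\<Pi>\<^sub>M i\<in>{..<m * n}. Y) (shuffle_mechanism Y A)"
proof
  note replace = shuffle_mechanism_replace_many[OF assms(1-6)]
  show "bounded_local_EM_DP m
           (SUP w\<in>{0<..1}. h_bound \<alpha>\<^sub>0 \<delta> (real m) (real m) (real m * w) / w)
           (\<delta> * exp (h_bound \<alpha>\<^sub>0 \<delta> (real m) (real m) (real m)))
           (\<Pi>\<^sub>M i\<in>{..<m}. Y) (shuffle_mechanism Y A)"
    unfolding bounded_local_EM_DP_def using replace[of _ _ m "{#}"] by simp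
  show "bounded_central_EM_DP n m
           (SUP w\<in>{0<..1}. h_bound \<alpha>\<^sub>0 \<delta> (real (m * n)) (real m) (real m * w) / w)
           (\<delta> * exp (h_bound \<alpha>\<^sub>0 \<delta> (real (m * n)) (real m) (real m)))
           (\<Pi>\<^sub>M i\<in>{..<m * n}. Y) (shuffle_mechanism Y A)"
    unfolding bounded_central_EM_DP_def
  proof (intro allI impI ballI, elim conjE)
    fix K :: "nat \<Rightarrow> 'a multiset" and i K' and S :: "(nat \<Rightarrow> 'b) set"
    assume K: "\<forall>j\<in>{1..n}. K j \<noteq> {#} \<and> size (K j) = m" and i: "i \<in> {1..n}" and K': "size (K' :: 'a multiset) = m"
      and S: "S \<in> sets (\<Pi>\<^sub>M i\<in>{..<m * n}. Y)"
    define R where "R = (\<Sum>j\<in>{1..n} - {i}. K j)"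
    have "size R = (\<Sum>j\<in>{1..n} - {i}. size (K j))"
      unfolding R_def using sum_comp_morphism[of size K "{1..n} - {i}"] by (simp add: o_def)
    also have "\<dots> = (\<Sum>j\<in>{1..n} - {i}. m)" using K by (intro sum.cong) auto
    finally have "size R = (\<Sum>j\<in>{1..n} - {i}. m)" .
    then have "size R = m * (n - 1)" using i by simp
    then have N: "m * n = m + size R" using assms(7) by (cases n) auto
    have 1: "(\<Sum>j=1..n. K j) = K i + R" unfolding R_def using i by (intro sum.remove) auto
    have "(\<Sum>j=1..n. (K(i := K')) j) = K' + (\<Sum>j\<in>{1..n} - {i}. (K(i := K')) j)"
      using i by (subst sum.remove[of _ i]) auto
    also have "(\<Sum>j\<in>{1..n} - {i}. (K(i := K')) j) = R" unfolding R_def by (intro sum.cong) auto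
    finally have 2: "(\<Sum>j=1..n. (K(i := K')) j) = K' + R" .
    show "measure (shuffle_mechanism Y A (\<Sum>j=1..n. K j)) S
        \<le> exp ((SUP w\<in>{0<..1}. h_bound \<alpha>\<^sub>0 \<delta> (real (m * n)) (real m) (real m * w) / w)
            * earth_mover_dist (pmf_of_multiset (K i)) (pmf_of_multiset K'))
          * measure (shuffle_mechanism Y A (\<Sum>j=1..n. (K(i := K')) j)) S
          + \<delta> * exp (h_bound \<alpha>\<^sub>0 \<delta> (real (m * n)) (real m) (real m))"
      unfolding 1 2 using K i K' N S by (intro replace) auto
  qed
qed

end
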